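(* For each positive integer $n$ let $X_n$ be the random variable `size' on the set of $(2n+1,2n+3)$-core partitions with distinct parts, equipped with the uniform distribution. Then $X_n$ is not asymptotically normal as $n\to\infty$; that is, the standardized random variables $(X_n-\mathbb{E}[X_n])/\sqrt{\mathrm{Var}(X_n)}$ do not converge in distribution to the standard normal distribution.
   Context: A partition is a non-increasing finite sequence $\lambda=(\lambda_1,\dots,\lambda_k)$, $k\ge 0$, of positive integers (the empty partition is allowed); its size is $\lambda_1+\dots+\lambda_k$, and it has distinct parts if the $\lambda_i$ are pairwise distinct. The hook length of a cell $(i,j)$, $1\le j\le\lambda_i$, of its Ferrers (Young) diagram is $\lambda_i-i+\lambda'_j-j+1$, where $\lambda'$ is the conjugate partition. A partition is an $(s,t)$-core partition if none of its hook lengths equals $s$ and none equals $t$. For $s=2n+1$, $t=2n+3$ (relatively prime) the set of $(s,t)$-core partitions is finite. *)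

theory Defs
  imports "HOL-Probability.Probability"
begin

definition is_partition :: "nat list \<Rightarrow> bool" where
  "is_partition xs \<longleftrightarrow> sorted_wrt (\<ge>) xs \<and> (\<forall>p \<in> set xs. 0 < p)"

text \<open>Rows and columns of Ferrers diagrams are numbered from 1.\<close>

definition part :: "nat list \<Rightarrow> nat \<Rightarrow> nat" where
  "part xs i = xs ! (i - 1)"

definition ferrers :: "nat list \<Rightarrow> (nat \<times> nat) set" where
  "ferrers xs = {(i, j). 1 \<le> i \<and> i \<le> length xs \<and> 1 \<le> j \<and> j \<le> part xs i}"

definition conjugate_part :: "nat list \<Rightarrow> nat \<Rightarrow> nat" where
  "conjugate_part xs j = card {i. (i, j) \<in> ferrers xs}"

text \<open>Integer-valued, because the difference of a part and its index can be negative.\<close>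

definition hook_length :: "nat list \<Rightarrow> nat \<Rightarrow> nat \<Rightarrow> int" where
  "hook_length xs i j = int (part xs i) - int i + int (conjugate_part xs j) - int j + 1"

definition is_core :: "nat \<Rightarrow> nat \<Rightarrow> nat list \<Rightarrow> bool" where
  "is_core s t xs \<longleftrightarrow> is_partition xs \<and>
     (\<forall>(i, j) \<in> ferrers xs. hook_length xs i j \<noteq> int s \<and> hook_length xs i j \<noteq> int t)"

definition distinct_cores :: "nat \<Rightarrow> nat \<Rightarrow> nat list set" where
  "distinct_cores s t = {xs. is_core s t xs \<and> distinct xs}"

definition psize :: "nat list \<Rightarrow> real" where
  "psize xs = real (sum_list xs)"

text \<open>\<open>pmf_of_set\<close> is the uniform distribution for finite nonempty sets only;
  the set below is finite because \<open>2 * n + 1\<close> and \<open>2 * n + 3\<close> are coprime, and it contains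
  the empty partition.\<close>

definition core_pmf :: "nat \<Rightarrow> nat list pmf" where
  "core_pmf n = pmf_of_set (distinct_cores (2 * n + 1) (2 * n + 3))"

definition standardized :: "'a pmf \<Rightarrow> ('a \<Rightarrow> real) \<Rightarrow> 'a \<Rightarrow> real" where
  "standardized p X x =
     (X x - measure_pmf.expectation p X) / sqrt (measure_pmf.variance p X)"

end

theory Submission
  imports Defs
begin

text \<open>
  A size is never negative, while a normal variable falls below every bound with positive
  probability.  If the standardized sizes converged to the normal law, the ratio of mean to
  standard deviation would therefore tend to infinity, and the size would concentrate around its
  mean: for a fixed \<open>c > 0\<close> and all large \<open>n\<close>, no number \<open>a\<close> could satisfy both
  \<open>P(X \<le> a) \<ge> c\<close> and \<open>P(X \<ge> 2 * a) \<ge> c\<close> (\<open>nonneg_asymp_normal_concentrates\<close>).  But the size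
  keeps fluctuating on the scale \<open>n\<^sup>3\<close> (\<open>core_size_not_concentrated\<close>): both inequalities hold
  for \<open>a = 480 * n\<^sup>3\<close> when \<open>n\<close> is a large square.

  Put \<open>s = 2 * n + 1\<close>.  A partition is encoded by its beta set, the set of hook lengths of its
  first column.  Distinct parts mean that the beta set has no two consecutive elements, and the core
  conditions mean that it is closed under subtraction of \<open>s\<close> and of \<open>s + 2\<close>.  Counting the elements
  in each residue class modulo \<open>s\<close> turns the cores into words \<open>c\<^sub>1 \<dots> c\<^sub>2\<^sub>n\<close> of natural numbers in which
  a letter exceeds the letter two places earlier by at most 1, of two adjacent letters one is 0, and
  \<open>c\<^sub>1 \<le> c\<^sub>2\<^sub>n + 2\<close> (\<open>bij_betw_core_of\<close>).  Up to constant factors the size is \<open>n\<close> times the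
  sum \<open>Q\<close> of the squares of the letters, unless \<open>Q\<close> is very small (\<open>psize_core_of_le\<close>, \<open>psize_core_of_ge\<close>).

  The words behave like random walks, and they can be counted exactly: the number of words starting
  from a given state has a closed binomial form (\<open>card_paths_ge_closed\<close>).  So there are
  \<open>(2 * n + 1) choose (n + 1 - k)\<close> words with \<open>c\<^sub>1 = k \<ge> 3\<close>, and the number of those with
  \<open>c\<^sub>r = j \<ge> 1\<close> is a product of two binomial coefficients.  That product is, after an affine change
  of \<open>j\<close>, the distribution of an order statistic of a random subset of \<open>2 * n + 1\<close> points, whose mean
  and variance are elementary.  By Markov's and Chebyshev's inequalities a first letter \<open>k \<le> 2 * \<surd>n\<close>
  gives \<open>Q \<le> 160 * n\<^sup>2\<close> with probability at least \<open>1 / 2\<close>, whereas a first letter \<open>k\<close> larger than a suitable multiple of \<open>\<surd>n\<close>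
  makes \<open>Q \<ge> n * k\<^sup>2 / 320\<close> with probability at least \<open>1 / 4\<close>.  For \<open>n = w\<^sup>2\<close> the first letter lies
  in \<open>{w<..2 * w}\<close> and in \<open>{1200 * w<..2400 * w}\<close> with probabilities bounded away from 0, and this
  produces the two scales.
\<close>

section \<open>Moments of an order statistic\<close>

text \<open>A subset of \<open>{0..M}\<close> with \<open>a + b + 1\<close> elements is determined by its \<open>(a + 1)\<close>-st smallest
  element \<open>u\<close>, \<open>a\<close> elements below \<open>u\<close> and \<open>b\<close> elements above it.\<close>

lemma sum_choose_mult_choose:
  "(\<Sum>u\<le>M. (u choose a) * ((M - u) choose b)) = Suc M choose Suc (a + b)"
proof (induction M arbitrary: b)
  case 0
  show ?case by (cases a; cases b) auto
next
  case (Suc M)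
  show ?case
  proof (cases b)
    case 0
    then show ?thesis using sum_choose_upper[of a "Suc M"] by simp
  next
    case (Suc b')
    have "(\<Sum>u\<le>Suc M. (u choose a) * ((Suc M - u) choose b))
        = (\<Sum>u\<le>M. (u choose a) * ((Suc M - u) choose b))"
      using Suc by simp
    also have "\<dots> = (\<Sum>u\<le>M. (u choose a) * ((M - u) choose b) + (u choose a) * ((M - u) choose b'))"
      by (intro sum.cong refl) (simp add: Suc Suc_diff_le algebra_simps)
    also have "\<dots> = (Suc M choose Suc (a + b)) + (Suc M choose Suc (a + b'))"
      by (simp add: sum.distrib Suc.IH)
    finally show ?thesis using Suc by simp
  qed
qed

text \<open>The number of \<open>(a + b + 1)\<close>-element subsets of \<open>{0..M}\<close> whose \<open>(a + 1)\<close>-st smallest element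
  is \<open>u\<close>.\<close>

definition order_stat_weight :: "nat \<Rightarrow> nat \<Rightarrow> nat \<Rightarrow> nat \<Rightarrow> nat" where
  "order_stat_weight M a b u = (u choose a) * ((M - u) choose b)"

lemma sum_order_stat_weight:
  "(\<Sum>u\<le>M. order_stat_weight M a b u) = Suc M choose Suc (a + b)"
  unfolding order_stat_weight_def by (rule sum_choose_mult_choose)

text \<open>The rising factors \<open>u + 1\<close> and \<open>(u + 1) * (u + 2)\<close> are absorbed into \<open>u choose a\<close>, which
  gives a weight of the same kind; this is why the moments of an order statistic are explicit.\<close>

lemma sum_order_stat_weight_1:
  "(\<Sum>u\<le>M. Suc u * order_stat_weight M a b u) = Suc a * ((M + 2) choose (a + b + 2))"
proof -
  have "(\<Sum>u\<le>M. Suc u * order_stat_weight M a b u)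
      = (\<Sum>u\<le>M. Suc a * ((Suc u choose Suc a) * ((Suc M - Suc u) choose b)))"
    unfolding order_stat_weight_def
    by (intro sum.cong refl) (metis Suc_times_binomial_eq diff_Suc_Suc mult.assoc mult.commute)
  also have "\<dots> = Suc a * (\<Sum>v\<le>Suc M. (v choose Suc a) * ((Suc M - v) choose b))"
    by (subst sum.atMost_Suc_shift) (simp add: sum_distrib_left)
  finally show ?thesis by (simp add: sum_choose_mult_choose del: binomial_Suc_Suc)
qed

lemma sum_order_stat_weight_2:
  "(\<Sum>u\<le>M. Suc u * (u + 2) * order_stat_weight M a b u)
     = Suc a * (a + 2) * ((M + 3) choose (a + b + 3))"
proof -
  have "(\<Sum>u\<le>M. Suc u * (u + 2) * order_stat_weight M a b u)
      = Suc a * (\<Sum>u\<le>M. Suc (Suc u) * order_stat_weight (Suc M) (Suc a) b (Suc u))"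
    unfolding order_stat_weight_def sum_distrib_left
  proof (intro sum.cong refl)
    fix u
    have "Suc u * (u choose a) = Suc a * (Suc u choose Suc a)"
      by (metis Suc_times_binomial_eq mult.commute)
    then show "Suc u * (u + 2) * ((u choose a) * (M - u choose b))
        = Suc a * (Suc (Suc u) * ((Suc u choose Suc a) * (Suc M - Suc u choose b)))"
      by (metis (no_types, lifting) add_2_eq_Suc' diff_Suc_Suc mult.assoc mult.left_commute)
  qed
  also have "\<dots> = Suc a * (\<Sum>v\<le>Suc M. Suc v * order_stat_weight (Suc M) (Suc a) b v)"
    using sum.atMost_Suc_shift[of "\<lambda>v. Suc v * order_stat_weight (Suc M) (Suc a) b v" M]
    by (simp add: order_stat_weight_def)
  also have "\<dots> = Suc a * (a + 2) * ((M + 3) choose (a + b + 3))"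
    by (simp only: sum_order_stat_weight_1) (simp add: numeral_3_eq_3 algebra_simps del: binomial_Suc_Suc)
  finally show ?thesis .
qed

text \<open>The exact variance has the additional factor \<open>(b + 1) / (a + b + 2)\<close>, which is at most 1.\<close>

lemma order_stat_variance:
  fixes a b M :: nat
  assumes "a + b \<le> M"
  defines "\<mu> \<equiv> real (a + 1) * real (M + 2) / real (a + b + 2)"
  shows "(\<Sum>u\<le>M. real (order_stat_weight M a b u) * (real u + 1 - \<mu>)\<^sup>2)
      \<le> real (Suc M choose Suc (a + b)) *
         (real (a + 1) * real (M + 2) * real (M - (a + b)) / (real (a + b + 2) * real (a + b + 3)))"
proof -
  define B where "B = real (Suc M choose Suc (a + b))"
  define s where "s = real (a + b + 2)"
  have s: "s > 0" by (simp add: s_def)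
  let ?w = "\<lambda>u. real (order_stat_weight M a b u)"
  have B1: "real ((M + 2) choose (a + b + 2)) = B * real (M + 2) / s"
    using arg_cong[OF Suc_times_binomial_eq[of "Suc M" "Suc (a+b)"], of real]
    unfolding B_def s_def of_nat_mult by (simp add: field_simps del: binomial_Suc_Suc)
  have B2: "real ((M + 3) choose (a + b + 3)) = B * real (M + 2) * real (M + 3) / (s * (s + 1))"
  proof -
    have "real (M + 3) * real ((M + 2) choose (a + b + 2)) = real ((M + 3) choose (a + b + 3)) * (s + 1)"
      using arg_cong[OF Suc_times_binomial_eq[of "M + 2" "a + b + 2"], of real]
      unfolding s_def of_nat_mult by (simp add: numeral_3_eq_3 add_ac del: binomial_Suc_Suc)
    then have "real ((M + 3) choose (a + b + 3)) = real (M + 3) * (B * real (M + 2) / s) / (s + 1)"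
      unfolding B1 using s by (simp add: eq_divide_eq del: of_nat_add)
    then show ?thesis by (simp add: mult_ac)
  qed
  have S0: "(\<Sum>u\<le>M. ?w u) = B"
    unfolding B_def using sum_order_stat_weight[of M a b] by (metis of_nat_sum)
  have S1: "(\<Sum>u\<le>M. (real u + 1) * ?w u) = real (a + 1) * (B * real (M + 2) / s)"
    using arg_cong[OF sum_order_stat_weight_1[of M a b], of real]
    unfolding B1[symmetric] of_nat_sum of_nat_mult by (simp add: add.commute del: binomial_Suc_Suc)
  have S2: "(\<Sum>u\<le>M. (real u + 1) * (real u + 2) * ?w u)
      = real (a + 1) * real (a + 2) * (B * real (M + 2) * real (M + 3) / (s * (s + 1)))"
    using arg_cong[OF sum_order_stat_weight_2[of M a b], of real]
    unfolding B2[symmetric] of_nat_sum of_nat_mult by (simp add: add.commute del: binomial_Suc_Suc)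
  have "(\<Sum>u\<le>M. ?w u * (real u + 1 - \<mu>)\<^sup>2)
      = (\<Sum>u\<le>M. (real u + 1) * (real u + 2) * ?w u - (2 * \<mu> + 1) * ((real u + 1) * ?w u) + \<mu>\<^sup>2 * ?w u)"
    by (intro sum.cong refl) (simp add: algebra_simps power2_eq_square)
  also have "\<dots> = (\<Sum>u\<le>M. (real u + 1) * (real u + 2) * ?w u)
       - (2 * \<mu> + 1) * (\<Sum>u\<le>M. (real u + 1) * ?w u) + \<mu>\<^sup>2 * (\<Sum>u\<le>M. ?w u)"
    by (simp only: sum.distrib sum_subtractf sum_distrib_left)
  also have "\<dots> = B * (real (a + 1) * real (a + 2) * real (M + 2) * real (M + 3) / (s * (s + 1))
       - (2 * \<mu> + 1) * \<mu> + \<mu>\<^sup>2)"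
  proof -
    have S1': "(\<Sum>u\<le>M. (real u + 1) * ?w u) = B * \<mu>"
      unfolding S1 \<mu>_def s_def by simp
    show ?thesis unfolding S0 S1' S2
      by (simp only: right_diff_distrib distrib_left) (simp add: mult_ac del: of_nat_add)
  qed
  also have "\<dots> = B * (\<mu> * (real (a + 2) * real (M + 3) / (s + 1) - 1 - \<mu>))"
  proof -
    have "real (a + 1) * real (a + 2) * real (M + 2) * real (M + 3) / (s * (s + 1))
        = \<mu> * (real (a + 2) * real (M + 3) / (s + 1))"
      unfolding \<mu>_def s_def[symmetric] by (simp add: divide_inverse mult_ac del: of_nat_add)
    then show ?thesis by (simp add: algebra_simps power2_eq_square del: of_nat_add)
  qed
  also have "real (a + 2) * real (M + 3) / (s + 1) - 1 - \<mu>
      = real (b + 1) / s * (real (M - (a + b)) / (s + 1))"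
  proof -
    have M: "real M = real (M - (a + b)) + real a + real b" using assms by simp
    have s': "s = real a + real b + 2" by (simp add: s_def)
    show ?thesis
      unfolding \<mu>_def s_def[symmetric] using s
      apply (simp add: divide_simps)
      unfolding M s' by (simp add: algebra_simps)
  qed
  also have "\<mu> * (real (b + 1) / s * (real (M - (a + b)) / (s + 1)))
      \<le> \<mu> * (1 * (real (M - (a + b)) / (s + 1)))"
  proof (intro mult_left_mono mult_right_mono)
    show "real (b + 1) / s \<le> 1" by (simp add: s_def)
  qed (use s in \<open>simp_all add: \<mu>_def\<close>)
  also have "\<mu> * (1 * (real (M - (a + b)) / (s + 1)))
      = real (a + 1) * real (M + 2) * real (M - (a + b)) / (s * (s + 1))"
    unfolding \<mu>_def s_def[symmetric] using s by simp
  finally show ?thesis unfolding B_def s_def by (simp add: mult_left_mono add.commute)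
qed

section \<open>Closed formulas for path counts\<close>

text \<open>The parameters \<open>a\<close> and \<open>b\<close> are the two letters before the word, which is all that the
  local rules refer to.  Since one of two adjacent letters vanishes, the reachable states are
  \<open>(h, 0)\<close> and \<open>(0, h)\<close>.\<close>

fun valid_path :: "nat \<Rightarrow> nat \<Rightarrow> nat list \<Rightarrow> bool" where
  "valid_path a b [] \<longleftrightarrow> True"
| "valid_path a b (x # xs) \<longleftrightarrow> x \<le> Suc a \<and> (b = 0 \<or> x = 0) \<and> valid_path b x xs"

text \<open>The condition on the last letter is the one that links the end of a word to its first letter.
  In \<open>last (b # xs)\<close> the letter \<open>b\<close> only serves the empty word.\<close>

definition paths_ge :: "nat \<Rightarrow> nat \<Rightarrow> nat \<Rightarrow> nat \<Rightarrow> nat list set" where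
  "paths_ge q m a b = {xs. length xs = m \<and> valid_path a b xs \<and> q \<le> last (b # xs)}"

lemma valid_path_bound:
  "valid_path a b xs \<Longrightarrow> x \<in> set xs \<Longrightarrow> x \<le> max a b + length xs"
proof (induction xs arbitrary: a b)
  case (Cons y ys)
  show ?case
  proof (cases "x = y")
    case False
    then have "x \<le> max b y + length ys" using Cons by auto
    then show ?thesis using Cons.prems by auto
  qed (use Cons.prems in auto)
qed simp

lemma finite_valid_paths: "finite {xs. length xs = m \<and> valid_path a b xs}"
proof (rule finite_subset)
  show "{xs. length xs = m \<and> valid_path a b xs}
      \<subseteq> {xs. set xs \<subseteq> {..max a b + m} \<and> length xs = m}"
    using valid_path_bound by auto
qed (rule finite_lists_length_eq, simp)

lemma finite_paths_ge: "finite (paths_ge q m a b)"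
  by (rule finite_subset[OF _ finite_valid_paths[of m a b]]) (auto simp: paths_ge_def)

lemma card_paths_ge_0: "card (paths_ge q 0 a b) = (if q \<le> b then 1 else 0)"
proof -
  have "paths_ge q 0 a b = (if q \<le> b then {[]} else {})" by (auto simp: paths_ge_def)
  then show ?thesis by simp
qed

lemma card_paths_ge_Suc:
  "card (paths_ge q (Suc m) a b) = (\<Sum>x\<le>(if b = 0 then Suc a else 0). card (paths_ge q m b x))"
proof -
  have "paths_ge q (Suc m) a b
      = (\<Union>x\<in>{..(if b = 0 then Suc a else 0)}. (#) x ` paths_ge q m b x)"
  proof (rule set_eqI)
    fix ys
    show "ys \<in> paths_ge q (Suc m) a b \<longleftrightarrow>
        ys \<in> (\<Union>x\<in>{..(if b = 0 then Suc a else 0)}. (#) x ` paths_ge q m b x)"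
      by (cases ys) (auto simp: paths_ge_def)
  qed
  also have "card \<dots> = (\<Sum>x\<le>(if b = 0 then Suc a else 0). card ((#) x ` paths_ge q m b x))"
    by (rule card_UN_disjoint) (auto simp: finite_paths_ge)
  finally show ?thesis by (simp add: card_image)
qed

text \<open>After a nonzero letter the next one must be 0, so only the states \<open>(h, 0)\<close> matter.\<close>

lemma card_paths_ge_pos:
  "b > 0 \<Longrightarrow> card (paths_ge q (Suc m) a b) = card (paths_ge q m b 0)"
  by (simp add: card_paths_ge_Suc)

lemma card_paths_ge_zero_0:
  "card (paths_ge q (Suc (Suc m)) 0 0) = card (paths_ge q (Suc m) 0 0) + card (paths_ge q m 1 0)"
  by (subst card_paths_ge_Suc) (simp add: card_paths_ge_pos)

text \<open>Raising \<open>h\<close> by one allows exactly one further value \<open>h + 2\<close> of the next letter.  This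
  Pascal-like recursion is what makes the counts binomial coefficients.\<close>

lemma card_paths_ge_zero_Suc:
  "card (paths_ge q (Suc (Suc m)) (Suc h) 0)
     = card (paths_ge q (Suc (Suc m)) h 0) + card (paths_ge q m (Suc (Suc h)) 0)"
  by (subst (1 2) card_paths_ge_Suc) (simp add: card_paths_ge_pos)

text \<open>Both parities have to be treated together: a 0 placed after the state \<open>(h, 0)\<close> uses up one
  position, whereas a nonzero letter and the 0 forced by it use up two.  For odd lengths the formula
  relies on truncated subtraction giving 0 when \<open>q\<close> is out of reach.\<close>

lemma card_paths_ge_closed:
  assumes "q \<ge> 1"
  shows "card (paths_ge q (2 * p) h 0) = (if q \<le> p then (2 * p + h + 1 - q) choose (p - q) else 0)
       \<and> card (paths_ge q (2 * p + 1) h 0) = (2 * p + 2 + h - q) choose Suc p"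
proof (induction p arbitrary: h)
  case 0
  have "card (paths_ge q 1 h 0) = h + 2 - q" for h
  proof -
    have "card (paths_ge q 1 h 0) = (\<Sum>x\<le>Suc h. if q \<le> x then 1 else 0)"
      by (simp add: card_paths_ge_Suc[of q 0, simplified] card_paths_ge_0)
    also have "\<dots> = card {q..Suc h}"
    proof -
      have "{x. x \<le> Suc h \<and> q \<le> x} = {q..Suc h}" by auto
      then show ?thesis by (subst sum.inter_filter[symmetric]) auto
    qed
    finally show ?thesis by simp
  qed
  then show ?case using assms by (auto simp: card_paths_ge_0)
next
  case (Suc p)
  note IH = Suc.IH
  have even: "card (paths_ge q (2 * Suc p) h 0)
      = (if q \<le> Suc p then (2 * Suc p + h + 1 - q) choose (Suc p - q) else 0)" for h
  proof (induction h)
    case 0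
    have "card (paths_ge q (2 * Suc p) 0 0)
        = ((2 * p + 2 - q) choose Suc p) + (if q \<le> p then (2 * p + 2 - q) choose (p - q) else 0)"
      using card_paths_ge_zero_0[of q "2 * p"] Suc.IH by simp
    also have "\<dots> = (if q \<le> Suc p then (2 * Suc p + 1 - q) choose (Suc p - q) else 0)"
    proof (cases "q \<le> p")
      case True
      have "(2 * p + 2 - q) choose Suc p = (2 * p + 2 - q) choose (Suc p - q)"
        using True by (subst binomial_symmetric) auto
      moreover have "2 * Suc p + 1 - q = Suc (2 * p + 2 - q)" "Suc p - q = Suc (p - q)"
        using True by auto
      ultimately show ?thesis using True by simp
    qed (cases "q = Suc p"; simp add: binomial_eq_0)
    finally show ?case by simp
  next
    case (Suc h)
    have "card (paths_ge q (2 * Suc p) (Suc h) 0)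
      = card (paths_ge q (2 * Suc p) h 0) + card (paths_ge q (2 * p) (Suc (Suc h)) 0)"
      using card_paths_ge_zero_Suc[of q "2 * p" h] by simp
    also have "\<dots> = (if q \<le> Suc p then (2 * Suc p + h + 1 - q) choose (Suc p - q) else 0)
        + (if q \<le> p then (2 * Suc p + h + 1 - q) choose (p - q) else 0)"
      using Suc.IH IH[of "Suc (Suc h)"] by (simp add: add_ac)
    also have "\<dots> = (if q \<le> Suc p then (2 * Suc p + Suc h + 1 - q) choose (Suc p - q) else 0)"
    proof (cases "q \<le> p")
      case True
      then have "2 * Suc p + Suc h + 1 - q = Suc (2 * Suc p + h + 1 - q)" "Suc p - q = Suc (p - q)"
        by auto
      then show ?thesis using True by simp
    qed (cases "q = Suc p"; simp)
    finally show ?case .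
  qed
  have odd: "card (paths_ge q (2 * Suc p + 1) h 0) = (2 * Suc p + 2 + h - q) choose Suc (Suc p)" for h
  proof (induction h)
    case 0
    have "card (paths_ge q (2 * Suc p + 1) 0 0)
        = (if q \<le> Suc p then (2 * Suc p + 1 - q) choose (Suc p - q) else 0)
          + ((2 * Suc p + 1 - q) choose Suc p)"
      using card_paths_ge_zero_0[of q "2 * p + 1"] even[of 0] Suc.IH[of 1] by simp
    also have "(if q \<le> Suc p then (2 * Suc p + 1 - q) choose (Suc p - q) else 0)
        = (2 * Suc p + 1 - q) choose Suc (Suc p)"
    proof (cases "q \<le> Suc p")
      case True
      then show ?thesis by (subst (2) binomial_symmetric) auto
    qed (simp add: binomial_eq_0)
    also have "\<dots> + ((2 * Suc p + 1 - q) choose Suc p) = (2 * Suc p + 2 - q) choose Suc (Suc p)"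
    proof (cases "q \<le> 2 * Suc p + 1")
      case True
      then have "2 * Suc p + 2 - q = Suc (2 * Suc p + 1 - q)" by simp
      then show ?thesis by simp
    qed simp
    finally show ?case by simp
  next
    case (Suc h)
    have "card (paths_ge q (2 * Suc p + 1) (Suc h) 0)
      = card (paths_ge q (2 * Suc p + 1) h 0) + card (paths_ge q (2 * p + 1) (Suc (Suc h)) 0)"
      using card_paths_ge_zero_Suc[of q "2 * p + 1" h] by simp
    also have "\<dots> = ((2 * Suc p + 2 + h - q) choose Suc (Suc p)) + ((2 * Suc p + 2 + h - q) choose Suc p)"
      using Suc.IH IH[of "Suc (Suc h)"] by (simp add: add_ac)
    also have "\<dots> = (2 * Suc p + 2 + Suc h - q) choose Suc (Suc p)"
    proof (cases "q \<le> 2 * Suc p + 2 + h")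
      case True
      then have "2 * Suc p + 2 + Suc h - q = Suc (2 * Suc p + 2 + h - q)" by simp
      then show ?thesis by simp
    qed simp
    finally show ?case .
  qed
  show ?case using even odd by blast
qed

definition paths_eq :: "nat \<Rightarrow> nat \<Rightarrow> nat \<Rightarrow> nat \<Rightarrow> nat list set" where
  "paths_eq j m a b = {xs. length xs = m \<and> valid_path a b xs \<and> last (b # xs) = j}"

lemma card_paths_eq:
  "card (paths_eq j m a b) = card (paths_ge j m a b) - card (paths_ge (Suc j) m a b)"
proof -
  have "paths_eq j m a b = paths_ge j m a b - paths_ge (Suc j) m a b"
    unfolding paths_eq_def paths_ge_def by auto
  moreover have "paths_ge (Suc j) m a b \<subseteq> paths_ge j m a b"
    unfolding paths_ge_def by auto
  ultimately show ?thesis by (simp add: card_Diff_subset finite_paths_ge)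
qed

lemma card_paths_eq_pos: "b > 0 \<Longrightarrow> card (paths_eq j (Suc m) a b) = card (paths_eq j m b 0)"
  by (simp add: card_paths_eq card_paths_ge_pos)

lemma card_paths_eq_odd:
  assumes "j \<ge> 1"
  shows "card (paths_eq j (2 * p + 1) h 0)
    = (if j \<le> 2 * p + 1 + h then (2 * p + 1 + h - j) choose p else 0)"
proof (cases "j \<le> 2 * p + 1 + h")
  case True
  then have "2 * p + 2 + h - j = Suc (2 * p + 1 + h - j)" "2 * p + 2 + h - Suc j = 2 * p + 1 + h - j"
    by auto
  then show ?thesis using True assms
    card_paths_ge_closed[of j p h] card_paths_ge_closed[of "Suc j" p h] by (simp add: card_paths_eq)
next
  case False
  then show ?thesis using assms
    card_paths_ge_closed[of j p h] card_paths_ge_closed[of "Suc j" p h] by (simp add: card_paths_eq)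
qed

lemma card_paths_eq_even:
  assumes "j \<ge> 1"
  shows "card (paths_eq j (2 * p) h 0) = (if j \<le> p then (2 * p + h - j) choose (p - j) else 0)"
proof (cases "j < p")
  case True
  then have "2 * p + h + 1 - j = Suc (2 * p + h - j)" "p - j = Suc (p - Suc j)"
    "2 * p + h + 1 - Suc j = 2 * p + h - j"
    by auto
  then show ?thesis using True assms
    card_paths_ge_closed[of j p h] card_paths_ge_closed[of "Suc j" p h] by (simp add: card_paths_eq)
next
  case False
  then show ?thesis using assms
    card_paths_ge_closed[of j p h] card_paths_ge_closed[of "Suc j" p h] by (simp add: card_paths_eq)
qed

text \<open>If a nonzero letter ends the first part, the letter before it is 0, so the second part starts
  in a known state.  This Markov property splits counts at a prescribed nonzero letter.\<close>

lemma valid_path_append: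
  assumes "last (b # ys) > 0" "ys \<noteq> []"
  shows "valid_path a b (ys @ zs) \<longleftrightarrow> valid_path a b ys \<and> valid_path 0 (last ys) zs"
  using assms
proof (induction ys arbitrary: a b)
  case (Cons y ys)
  show ?case
  proof (cases "ys = []")
    case True
    then show ?thesis using Cons.prems by auto
  next
    case False
    then show ?thesis using Cons by auto
  qed
qed simp

lemma card_paths_split:
  assumes "j \<ge> 1" "m1 \<ge> 1"
  shows "card {xs \<in> paths_ge q (m1 + m2) a b. xs ! (m1 - 1) = j}
    = card (paths_eq j m1 a b) * card (paths_ge q m2 0 j)"
proof -
  have inj: "inj_on (\<lambda>(ys, zs). ys @ zs) (paths_eq j m1 a b \<times> paths_ge q m2 0 j)"
    by (auto simp: inj_on_def paths_eq_def)
  have "{xs \<in> paths_ge q (m1 + m2) a b. xs ! (m1 - 1) = j}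
      = (\<lambda>(ys, zs). ys @ zs) ` (paths_eq j m1 a b \<times> paths_ge q m2 0 j)" (is "?L = ?R")
  proof
    show "?R \<subseteq> ?L"
    proof clarify
      fix ys zs assume ys: "ys \<in> paths_eq j m1 a b" and zs: "zs \<in> paths_ge q m2 0 j"
      have ne: "ys \<noteq> []" using ys assms by (auto simp: paths_eq_def)
      then have l: "last ys = j" "length ys = m1" using ys by (auto simp: paths_eq_def)
      have v: "valid_path a b (ys @ zs)"
        using ys zs ne l assms by (subst valid_path_append) (auto simp: paths_ge_def paths_eq_def)
      have "last (b # ys @ zs) = last (j # zs)" using l ne by (cases zs) auto
      then show "ys @ zs \<in> paths_ge q (m1 + m2) a b \<and> (ys @ zs) ! (m1 - 1) = j"
        using v l ne zs assms by (auto simp: paths_ge_def nth_append last_conv_nth)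
    qed
    show "?L \<subseteq> ?R"
    proof
      fix xs assume xs: "xs \<in> ?L"
      define ys zs where "ys = take m1 xs" and "zs = drop m1 xs"
      have e: "xs = ys @ zs" by (simp add: ys_def zs_def)
      have len: "length ys = m1" "length zs = m2" using xs by (auto simp: ys_def zs_def paths_ge_def)
      have ne: "ys \<noteq> []" using len assms by auto
      have l: "last ys = j" using xs len ne assms by (auto simp: last_conv_nth ys_def)
      have "valid_path a b (ys @ zs)" using xs by (simp add: paths_ge_def flip: e)
      then have "valid_path a b ys" "valid_path 0 j zs"
        using valid_path_append[of b ys a zs] l ne assms by auto
      moreover have "last (b # ys @ zs) = last (j # zs)" using l ne by (cases zs) auto
      moreover have "q \<le> last (b # ys @ zs)" using xs by (simp add: paths_ge_def flip: e)
      ultimately have "(ys, zs) \<in> paths_eq j m1 a b \<times> paths_ge q m2 0 j"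
        using len l ne by (auto simp: paths_eq_def paths_ge_def)
      then show "xs \<in> ?R" unfolding e by (metis (mono_tags, lifting) case_prod_conv image_eqI)
    qed
  qed
  then show ?thesis using inj by (simp add: card_image card_cartesian_product)
qed

text \<open>The function \<open>2\<^sup>h\<close> on the states \<open>(h, 0)\<close> and \<open>(0, h + 1)\<close> grows by exactly the factor 2
  per letter: it is a positive eigenfunction of the transfer operator.\<close>

lemma card_valid_paths_le:
  "card (paths_ge 0 m h 0) \<le> 2 ^ h * 2 ^ m \<and> card (paths_ge 0 m 0 (Suc h)) \<le> 2 ^ h * 2 ^ m"
proof (induction m arbitrary: h)
  case 0
  show ?case by (simp add: card_paths_ge_0)
next
  case (Suc m)
  have "card (paths_ge 0 (Suc m) h 0) \<le> 2 ^ m + (\<Sum>x\<le>h. 2 ^ x * 2 ^ m)"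
  proof -
    have "card (paths_ge 0 (Suc m) h 0) = card (paths_ge 0 m 0 0) + (\<Sum>x\<le>h. card (paths_ge 0 m 0 (Suc x)))"
      by (simp add: card_paths_ge_Suc sum.atMost_Suc_shift del: sum.atMost_Suc)
    also have "\<dots> \<le> 2 ^ m + (\<Sum>x\<le>h. 2 ^ x * 2 ^ m)"
      using Suc[of 0] Suc by (intro add_mono sum_mono) auto
    finally show ?thesis .
  qed
  also have "\<dots> = 2 ^ h * 2 ^ Suc m"
    by (induction h) (auto simp: algebra_simps)
  finally have 1: "card (paths_ge 0 (Suc m) h 0) \<le> 2 ^ h * 2 ^ Suc m" .
  have "card (paths_ge 0 (Suc m) 0 (Suc h)) = card (paths_ge 0 m (Suc h) 0)"
    by (simp add: card_paths_ge_pos)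
  also have "\<dots> \<le> 2 ^ Suc h * 2 ^ m" using Suc by blast
  finally show ?case using 1 by simp
qed

text \<open>The words that encode the cores.  The letter before the first one is the number of beta
  set elements divisible by \<open>2 * n + 1\<close>, which is 0; this explains the state \<open>(0, k)\<close>.  The
  first letter itself is bounded only by the last one, because the class of 1 follows that of
  \<open>2 * n\<close> under addition of 2 modulo \<open>2 * n + 1\<close>.\<close>

definition configs :: "nat \<Rightarrow> nat list set" where
  "configs n = {cs. length cs = 2 * n \<and>
     (\<exists>k ys. cs = k # ys \<and> valid_path 0 k ys \<and> k \<le> last cs + 2)}"

section \<open>Words with a prescribed first letter\<close>

definition configs_at :: "nat \<Rightarrow> nat \<Rightarrow> nat list set" where
  "configs_at n k = {cs \<in> configs n. hd cs = k}"

lemma configs_at_subset: "configs_at n k \<subseteq> (#) k ` paths_ge 0 (2 * n - 1) 0 k"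
  by (auto simp: configs_at_def configs_def paths_ge_def)

text \<open>From \<open>k \<ge> 3\<close> on, the condition linking the two ends is a positive lower bound on the last
  letter, as the closed formulas require.\<close>

lemma configs_at_eq:
  assumes "k \<ge> 3" "n \<ge> 1"
  shows "configs_at n k = (#) k ` paths_ge (k - 2) (2 * n - 1) 0 k"
  using assms by (auto simp: configs_at_def configs_def paths_ge_def)

lemma finite_configs_at: "finite (configs_at n k)"
  by (rule finite_subset[OF configs_at_subset]) (simp add: finite_paths_ge)

lemma card_configs_at:
  assumes "k \<ge> 3" "n \<ge> 1"
  shows "card (configs_at n k) = (if k \<le> n + 1 then (2 * n + 1) choose (n + 1 - k) else 0)"
proof -
  have e: "2 * n - 1 = Suc (2 * (n - 1))" using assms by simp
  have "card (configs_at n k) = card (paths_ge (k - 2) (Suc (2 * (n - 1))) 0 k)"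
    unfolding configs_at_eq[OF assms] e by (simp add: card_image)
  also have "\<dots> = card (paths_ge (k - 2) (2 * (n - 1)) k 0)"
    using assms by (intro card_paths_ge_pos) auto
  also have "\<dots> = (if k - 2 \<le> n - 1 then (2 * (n - 1) + k + 1 - (k - 2)) choose (n - 1 - (k - 2)) else 0)"
    using card_paths_ge_closed[of "k - 2" "n - 1" k] assms by simp
  also have "\<dots> = (if k \<le> n + 1 then (2 * n + 1) choose (n + 1 - k) else 0)"
  proof -
    have "2 * (n - 1) + k + 1 - (k - 2) = 2 * n + 1" "n - 1 - (k - 2) = n + 1 - k"
      "k - 2 \<le> n - 1 \<longleftrightarrow> k \<le> n + 1" using assms by auto
    then show ?thesis by simp
  qed
  finally show ?thesis .
qed

lemma card_configs_at_nth:
  assumes "k \<ge> 3" "n \<ge> 1" "1 \<le> r" "r < 2 * n" "j \<ge> 1"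
  shows "card {cs \<in> configs_at n k. cs ! r = j}
    = card (paths_eq j r 0 k) * card (paths_ge (k - 2) (2 * n - 1 - r) 0 j)"
proof -
  have "{cs \<in> configs_at n k. cs ! r = j}
      = (#) k ` {xs \<in> paths_ge (k - 2) (r + (2 * n - 1 - r)) 0 k. xs ! (r - 1) = j}"
    using assms by (auto simp: configs_at_eq)
  then show ?thesis
    using card_paths_split[of j r "k - 2" "2 * n - 1 - r" 0 k] assms by (simp add: card_image)
qed

text \<open>Multiplying the counts of the two halves gives the weight of the \<open>i\<close>-th smallest element of a
  random subset with \<open>n + 1 - k\<close> elements.  Values \<open>u \<ge> 2 * i - 1 + k\<close> of that element, for which
  \<open>j\<close> would not be positive, correspond to the words whose letter vanishes.\<close>

lemma card_configs_at_odd_place: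
  assumes "k \<ge> 3" "1 \<le> i" "i < n" "i + k \<le> n + 1" "j \<ge> 1"
  shows "card {cs \<in> configs_at n k. cs ! (2 * i) = j}
    = (if j \<le> 2 * i - 1 + k then order_stat_weight (2 * n) (i - 1) (n + 1 - k - i) (2 * i - 1 + k - j) else 0)"
proof -
  have e1: "2 * i = Suc (2 * (i - 1) + 1)" using assms by simp
  have e2: "2 * n - 1 - 2 * i = Suc (2 * (n - 1 - i))" using assms by simp
  have "card {cs \<in> configs_at n k. cs ! (2 * i) = j}
      = card (paths_eq j (2 * i) 0 k) * card (paths_ge (k - 2) (2 * n - 1 - 2 * i) 0 j)"
    using assms by (intro card_configs_at_nth) auto
  also have "card (paths_eq j (2 * i) 0 k) = card (paths_eq j (2 * (i - 1) + 1) k 0)"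
    using assms by (subst e1) (rule card_paths_eq_pos, simp)
  also have "\<dots> = (if j \<le> 2 * i - 1 + k then (2 * i - 1 + k - j) choose (i - 1) else 0)"
  proof -
    have "2 * (i - 1) + 1 + k = 2 * i - 1 + k" using assms by simp
    then show ?thesis using card_paths_eq_odd[OF assms(5), of "i - 1" k] by simp
  qed
  also have "card (paths_ge (k - 2) (2 * n - 1 - 2 * i) 0 j) = card (paths_ge (k - 2) (2 * (n - 1 - i)) j 0)"
    using assms by (subst e2) (rule card_paths_ge_pos, simp)
  also have "\<dots> = (2 * (n - 1 - i) + j + 1 - (k - 2)) choose (n - 1 - i - (k - 2))"
    using card_paths_ge_closed[of "k - 2" "n - 1 - i" j] assms by simp
  also have "n - 1 - i - (k - 2) = n + 1 - k - i" using assms by simp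
  finally have c: "card {cs \<in> configs_at n k. cs ! (2 * i) = j}
    = (if j \<le> 2 * i - 1 + k then (2 * i - 1 + k - j) choose (i - 1) else 0)
      * ((2 * (n - 1 - i) + j + 1 - (k - 2)) choose (n + 1 - k - i))" .
  show ?thesis
  proof (cases "j \<le> 2 * i - 1 + k")
    case True
    have "2 * (n - 1 - i) + j + 1 - (k - 2) = 2 * n - (2 * i - 1 + k - j)"
      using True assms by simp
    then show ?thesis
      using True by (simp only: c order_stat_weight_def if_True)
  qed (simp add: c)
qed

lemma card_configs_at_odd_place_far:
  assumes "k \<ge> 3" "1 \<le> i" "i < n" "n + 1 < i + k" "j \<ge> 1"
  shows "card {cs \<in> configs_at n k. cs ! (2 * i) = j} = 0"
proof -
  have e2: "2 * n - 1 - 2 * i = Suc (2 * (n - 1 - i))" using assms by simp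
  have "card {cs \<in> configs_at n k. cs ! (2 * i) = j}
      = card (paths_eq j (2 * i) 0 k) * card (paths_ge (k - 2) (2 * n - 1 - 2 * i) 0 j)"
    using assms by (intro card_configs_at_nth) auto
  also have "card (paths_ge (k - 2) (2 * n - 1 - 2 * i) 0 j) = card (paths_ge (k - 2) (2 * (n - 1 - i)) j 0)"
    using assms by (subst e2) (rule card_paths_ge_pos, simp)
  also have "\<dots> = 0"
    using card_paths_ge_closed[of "k - 2" "n - 1 - i" j] assms by auto
  finally show ?thesis by simp
qed

text \<open>Here the \<open>(k + i)\<close>-th smallest element of a random subset with \<open>n + k\<close> elements occurs.  The
  inequality, in place of an equation, is enough for upper bounds on moments.\<close>

lemma card_configs_at_even_place_le:
  assumes "k \<ge> 3" "1 \<le> i" "i \<le> n" "j \<ge> 1"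
  shows "card {cs \<in> configs_at n k. cs ! (2 * i - 1) = j}
    \<le> (if j \<le> 2 * i - 2 + k \<and> 2 * i - 2 + k - j \<le> 2 * n
       then order_stat_weight (2 * n) (k + i - 1) (n - i) (2 * i - 2 + k - j) else 0)"
proof -
  have e1: "2 * i - 1 = Suc (2 * (i - 1))" using assms by simp
  have "card {cs \<in> configs_at n k. cs ! (2 * i - 1) = j}
      = card (paths_eq j (2 * i - 1) 0 k) * card (paths_ge (k - 2) (2 * n - 1 - (2 * i - 1)) 0 j)"
    using assms by (intro card_configs_at_nth) auto
  moreover have "card (paths_eq j (2 * i - 1) 0 k) = card (paths_eq j (2 * (i - 1)) k 0)"
    using assms by (subst e1) (rule card_paths_eq_pos, simp)
  moreover have "\<dots> = (if j \<le> 2 * i - 2 + k then (2 * i - 2 + k - j) choose (k + i - 1) else 0)"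
  proof (cases "j \<le> i - 1")
    case True
    then have "2 * (i - 1) + k - j = 2 * i - 2 + k - j" "2 * i - 2 + k - j - (i - 1 - j) = k + i - 1"
      "i - 1 - j \<le> 2 * i - 2 + k - j" "j \<le> 2 * i - 2 + k"
      using assms by auto
    then show ?thesis using True card_paths_eq_even[OF assms(4), of "i - 1" k]
      by (metis binomial_symmetric)
  next
    case False
    then show ?thesis using card_paths_eq_even[OF assms(4), of "i - 1" k] assms
      by (auto simp: binomial_eq_0)
  qed
  moreover have "card (paths_ge (k - 2) (2 * n - 1 - (2 * i - 1)) 0 j)
      = (if i = n then (if k - 2 \<le> j then 1 else 0) else (2 * (n - i) + j - (k - 2)) choose (n - i))"
  proof (cases "i = n")
    case True
    then show ?thesis by (simp add: card_paths_ge_0)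
  next
    case False
    have e2: "2 * n - 1 - (2 * i - 1) = Suc (2 * (n - 1 - i) + 1)" using assms False by simp
    have "card (paths_ge (k - 2) (2 * n - 1 - (2 * i - 1)) 0 j) = card (paths_ge (k - 2) (2 * (n - 1 - i) + 1) j 0)"
      using assms by (subst e2) (rule card_paths_ge_pos, simp)
    also have "\<dots> = (2 * (n - 1 - i) + 2 + j - (k - 2)) choose Suc (n - 1 - i)"
      using card_paths_ge_closed[of "k - 2" "n - 1 - i" j] assms by simp
    finally have "card (paths_ge (k - 2) (2 * n - 1 - (2 * i - 1)) 0 j)
      = (2 * (n - 1 - i) + 2 + j - (k - 2)) choose Suc (n - 1 - i)" .
    moreover have "2 * (n - 1 - i) + 2 = 2 * (n - i)" "Suc (n - 1 - i) = n - i"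
      using assms False by auto
    ultimately show ?thesis using False by presburger
  qed
  ultimately have c: "card {cs \<in> configs_at n k. cs ! (2 * i - 1) = j}
     = (if j \<le> 2 * i - 2 + k then (2 * i - 2 + k - j) choose (k + i - 1) else 0) *
       (if i = n then (if k - 2 \<le> j then 1 else 0) else (2 * (n - i) + j - (k - 2)) choose (n - i))"
    by presburger
  show ?thesis
  proof (cases "j \<le> 2 * i - 2 + k \<and> 2 * i - 2 + k - j \<le> 2 * n")
    case True
    then have e: "2 * (n - i) + j - (k - 2) = 2 * n - (2 * i - 2 + k - j)" using assms by auto
    show ?thesis using True unfolding c e order_stat_weight_def by auto
  next
    case False
    show ?thesis
    proof (cases "j \<le> 2 * i - 2 + k")
      case True
      then have "2 * n < 2 * i - 2 + k - j" using False by simp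
      then have "2 * (n - i) + j < k - 2" using assms by auto
      then show ?thesis unfolding c using assms by (auto simp: binomial_eq_0)
    qed (use c in auto)
  qed
qed

text \<open>The sum over all \<open>u\<close> also contains the terms in which \<open>C - u\<close> is negative.  They are
  harmless in an upper bound and make the moments of the full distribution applicable.\<close>

lemma sum_squares_le_shifted_weights:
  fixes g :: "'a \<Rightarrow> nat"
  assumes "finite A"
    and count: "\<And>j. j \<ge> 1 \<Longrightarrow> card {x \<in> A. g x = j} \<le> (if j \<le> C \<and> C - j \<le> M then w (C - j) else 0)"
  shows "(\<Sum>x\<in>A. (real (g x))\<^sup>2) \<le> (\<Sum>u\<le>M. real (w u) * (real C - real u)\<^sup>2)"
proof -
  have gC: "g ` A \<subseteq> {..C}"
  proof clarify
    fix x assume x: "x \<in> A"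
    show "g x \<le> C"
    proof (rule ccontr)
      assume "\<not> g x \<le> C"
      then have "card {y \<in> A. g y = g x} = 0" using count[of "g x"] by simp
      then show False using x assms(1) by auto
    qed
  qed
  have "(\<Sum>x\<in>A. (real (g x))\<^sup>2) = (\<Sum>j\<le>C. \<Sum>x\<in>{x \<in> A. g x = j}. (real (g x))\<^sup>2)"
    by (rule sum.group[symmetric]) (use assms(1) gC in auto)
  also have "\<dots> = (\<Sum>j\<le>C. real (card {x \<in> A. g x = j}) * (real j)\<^sup>2)"
    by (intro sum.cong refl) simp
  also have "\<dots> \<le> (\<Sum>j\<le>C. (if C - j \<le> M then real (w (C - j)) else 0) * (real j)\<^sup>2)"
  proof (intro sum_mono)
    fix j assume j: "j \<in> {..C}"
    show "real (card {x \<in> A. g x = j}) * (real j)\<^sup>2 \<le> (if C - j \<le> M then real (w (C - j)) else 0) * (real j)\<^sup>2"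
    proof (cases "j = 0")
      case False
      then have "card {x \<in> A. g x = j} \<le> (if C - j \<le> M then w (C - j) else 0)"
        using count[of j] j by auto
      then show ?thesis by (intro mult_right_mono) (auto split: if_splits)
    qed simp
  qed
  also have "\<dots> = (\<Sum>u\<le>C. (if u \<le> M then real (w u) else 0) * (real (C - u))\<^sup>2)"
    by (rule sum.reindex_bij_witness[where i="\<lambda>u. C - u" and j="\<lambda>u. C - u"]) auto
  also have "\<dots> = (\<Sum>u\<in>{u \<in> {..C}. u \<le> M}. real (w u) * (real C - real u)\<^sup>2)"
    by (subst sum.inter_filter) (auto intro!: sum.cong)
  also have "\<dots> \<le> (\<Sum>u\<le>M. real (w u) * (real C - real u)\<^sup>2)"
    by (rule sum_mono2) auto
  finally show ?thesis .
qed

text \<open>Second moment about an arbitrary centre: variance plus squared distance of the mean from the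
  centre, up to a factor 2.\<close>

lemma order_stat_second_moment:
  fixes a b M :: nat
  assumes "a + b \<le> M"
    and V: "real (a + 1) * real (M + 2) * real (M - (a + b)) / (real (a + b + 2) * real (a + b + 3)) \<le> v"
    and D: "\<bar>real (a + 1) * real (M + 2) / real (a + b + 2) - (real C + 1)\<bar> \<le> d"
  shows "(\<Sum>u\<le>M. real (order_stat_weight M a b u) * (real C - real u)\<^sup>2)
     \<le> real (Suc M choose Suc (a + b)) * (2 * v + 2 * d\<^sup>2)"
proof -
  define \<mu> where "\<mu> = real (a + 1) * real (M + 2) / real (a + b + 2)"
  let ?w = "\<lambda>u. real (order_stat_weight M a b u)"
  have d: "(\<mu> - (real C + 1))\<^sup>2 \<le> d\<^sup>2"
    using D unfolding \<mu>_def by (metis abs_ge_zero abs_le_square_iff abs_of_nonneg order.trans)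
  have S: "(\<Sum>u\<le>M. ?w u) = real (Suc M choose Suc (a + b))"
    by (metis of_nat_sum sum_order_stat_weight)
  have "(\<Sum>u\<le>M. ?w u * (real C - real u)\<^sup>2)
     \<le> (\<Sum>u\<le>M. 2 * (?w u * (real u + 1 - \<mu>)\<^sup>2) + 2 * d\<^sup>2 * ?w u)"
  proof (intro sum_mono)
    fix u
    have "(real C - real u)\<^sup>2 = ((real C + 1 - \<mu>) - (real u + 1 - \<mu>))\<^sup>2" by simp
    also have "\<dots> \<le> 2 * (real u + 1 - \<mu>)\<^sup>2 + 2 * (\<mu> - (real C + 1))\<^sup>2"
      using zero_le_power2[of "(real C + 1 - \<mu>) + (real u + 1 - \<mu>)"]
      by (simp add: power2_eq_square algebra_simps)
    also have "\<dots> \<le> 2 * (real u + 1 - \<mu>)\<^sup>2 + 2 * d\<^sup>2" using d by simp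
    finally have "?w u * (real C - real u)\<^sup>2 \<le> ?w u * (2 * (real u + 1 - \<mu>)\<^sup>2 + 2 * d\<^sup>2)"
      by (rule mult_left_mono) simp
    then show "?w u * (real C - real u)\<^sup>2 \<le> 2 * (?w u * (real u + 1 - \<mu>)\<^sup>2) + 2 * d\<^sup>2 * ?w u"
      by (simp add: algebra_simps)
  qed
  also have "\<dots> = 2 * (\<Sum>u\<le>M. ?w u * (real u + 1 - \<mu>)\<^sup>2) + 2 * d\<^sup>2 * (\<Sum>u\<le>M. ?w u)"
    by (simp only: sum.distrib sum_distrib_left)
  also have "\<dots> \<le> 2 * (real (Suc M choose Suc (a + b)) * v) + 2 * d\<^sup>2 * real (Suc M choose Suc (a + b))"
  proof -
    have "(\<Sum>u\<le>M. ?w u * (real u + 1 - \<mu>)\<^sup>2) \<le> real (Suc M choose Suc (a + b)) *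
         (real (a + 1) * real (M + 2) * real (M - (a + b)) / (real (a + b + 2) * real (a + b + 3)))"
      unfolding \<mu>_def by (rule order_stat_variance[OF assms(1)])
    also have "\<dots> \<le> real (Suc M choose Suc (a + b)) * v" by (rule mult_left_mono[OF V]) simp
    finally show ?thesis unfolding S by simp
  qed
  finally show ?thesis by (simp add: algebra_simps)
qed

section \<open>Second moments of single letters\<close>

text \<open>The order statistic has mean \<open>2 * i + 2 * i * (k - 1) / (n + 2 - k)\<close> and variance at most
  \<open>4 * n\<close>; shifted by \<open>2 * i + k\<close>, its mean is at most \<open>2 * k\<close> away from 0.\<close>

lemma second_moment_odd_place:
  assumes "k \<ge> 3" "8 * k \<le> n" "1 \<le> i" "i < n"
  shows "(\<Sum>cs\<in>configs_at n k. (real (cs ! (2 * i)))\<^sup>2)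
    \<le> real (card (configs_at n k)) * (2 * (4 * real n) + 2 * (2 * real k)\<^sup>2)"
proof (cases "i + k \<le> n + 1")
  case True
  define a b where "a = i - 1" and "b = n + 1 - k - i"
  have ab: "a + b = n - k" "Suc (a + b) = n + 1 - k" using True assms by (auto simp: a_def b_def)
  have r: "real (a + 1) = real i" "real (a + b + 2) = real n + 2 - real k"
    "real (a + b + 3) = real n + 3 - real k" "real (2 * n - (a + b)) = real n + real k"
    "real (2 * i - 1 + k) + 1 = 2 * real i + real k"
  proof -
    have "a + 1 = i" "a + b + k = n" "2 * n - (a + b) = n + k" "2 * i - 1 + k + 1 = 2 * i + k"
      using True assms by (auto simp: a_def b_def)
    then show "real (a + 1) = real i" "real (a + b + 2) = real n + 2 - real k"
      "real (a + b + 3) = real n + 3 - real k" "real (2 * n - (a + b)) = real n + real k"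
      "real (2 * i - 1 + k) + 1 = 2 * real i + real k" by linarith+
  qed
  have k8: "8 * real k \<le> real n" "real i \<le> real n" "real i \<ge> 1" "real k \<ge> 3" using assms by auto
  have "(\<Sum>cs\<in>configs_at n k. (real (cs ! (2 * i)))\<^sup>2)
     \<le> (\<Sum>u\<le>2 * n. real (order_stat_weight (2 * n) a b u) * (real (2 * i - 1 + k) - real u)\<^sup>2)"
  proof (rule sum_squares_le_shifted_weights[OF finite_configs_at])
    fix j :: nat assume j: "j \<ge> 1"
    have "2 * i - 1 + k - j \<le> 2 * n" using True j assms by linarith
    then show "card {cs \<in> configs_at n k. cs ! (2 * i) = j} \<le>
        (if j \<le> 2 * i - 1 + k \<and> 2 * i - 1 + k - j \<le> 2 * n
         then order_stat_weight (2 * n) a b (2 * i - 1 + k - j) else 0)"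
      using card_configs_at_odd_place[OF assms(1,3,4) True j] by (simp add: a_def b_def)
  qed
  also have "\<dots> \<le> real (Suc (2 * n) choose Suc (a + b)) * (2 * (4 * real n) + 2 * (2 * real k)\<^sup>2)"
  proof (rule order_stat_second_moment)
    show "a + b \<le> 2 * n" by (simp add: ab)
    have "real i * real (2 * n + 2) * (real n + real k) \<le> real n * ((2 * real n + 2) * (9 / 8 * real n))"
      using k8 unfolding mult.assoc by (intro mult_mono) auto
    also have "\<dots> \<le> real n * (4 * ((7 / 8 * real n + 2) * (7 / 8 * real n + 3)))"
    proof (rule mult_left_mono)
      have "4 * ((7 / 8 * real n + 2) * (7 / 8 * real n + 3)) - (2 * real n + 2) * (9 / 8 * real n)
          = 13 / 16 * (real n * real n) + 61 / 4 * real n + 24"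
        by (simp add: field_simps)
      moreover have "\<dots> \<ge> 0" by (intro add_nonneg_nonneg mult_nonneg_nonneg) auto
      ultimately show "(2 * real n + 2) * (9 / 8 * real n) \<le> 4 * ((7 / 8 * real n + 2) * (7 / 8 * real n + 3))"
        by linarith
    qed simp
    also have "\<dots> \<le> real n * (4 * ((real n + 2 - real k) * (real n + 3 - real k)))"
      using k8 by (intro mult_left_mono mult_mono) auto
    also have "\<dots> = 4 * real n * ((real n + 2 - real k) * (real n + 3 - real k))" by (simp only: mult_ac)
    finally show "real (a + 1) * real (2 * n + 2) * real (2 * n - (a + b)) / (real (a + b + 2) * real (a + b + 3))
      \<le> 4 * real n"
      unfolding r
      by (rule pos_divide_le_eq[THEN iffD2, rotated]) (use k8 in auto)
    have pos: "real n + 2 - real k > 0" using k8 by simp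
    have "real i * real (2 * n + 2) / (real n + 2 - real k) = 2 * real i + 2 * real i * (real k - 1) / (real n + 2 - real k)"
      using pos by (simp add: field_simps)
    moreover have "0 \<le> 2 * real i * (real k - 1) / (real n + 2 - real k)" using k8 pos by auto
    moreover have "2 * real i * (real k - 1) / (real n + 2 - real k) \<le> 3 * real k"
    proof (subst pos_divide_le_eq[OF pos])
      have "2 * real i * (real k - 1) \<le> 2 * real n * real k" using k8 by (intro mult_mono) auto
      also have "\<dots> \<le> 3 * real k * (7 / 8 * real n)" by (simp add: mult.commute mult_left_mono)
      also have "\<dots> \<le> 3 * real k * (real n + 2 - real k)" using k8 by (intro mult_left_mono) auto
      finally show "2 * real i * (real k - 1) \<le> 3 * real k * (real n + 2 - real k)" .
    qed
    ultimately show "\<bar>real (a + 1) * real (2 * n + 2) / real (a + b + 2) - (real (2 * i - 1 + k) + 1)\<bar> \<le> 2 * real k"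
      unfolding r by linarith
  qed
  also have "real (Suc (2 * n) choose Suc (a + b)) = real (card (configs_at n k))"
    using card_configs_at[OF assms(1), of n] assms unfolding ab(2) by simp
  finally show ?thesis .
next
  case False
  have "cs ! (2 * i) = 0" if "cs \<in> configs_at n k" for cs
  proof (rule ccontr)
    assume "cs ! (2 * i) \<noteq> 0"
    then have "card {cs' \<in> configs_at n k. cs' ! (2 * i) = cs ! (2 * i)} = 0"
      using False assms by (intro card_configs_at_odd_place_far) auto
    then show False using that finite_configs_at[of n k] by auto
  qed
  then show ?thesis by (simp add: sum_nonneg)
qed

lemma second_moment_even_place:
  assumes "k \<ge> 3" "8 * k \<le> n" "1 \<le> i" "i \<le> n"
  shows "(\<Sum>cs\<in>configs_at n k. (real (cs ! (2 * i - 1)))\<^sup>2)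
    \<le> real (card (configs_at n k)) * (2 * (4 * real n) + 2 * (2 * real k)\<^sup>2)"
proof -
  define a b where "a = k + i - 1" and "b = n - i"
  have ab: "a + b = n + k - 1" "Suc (a + b) = n + k" using assms by (auto simp: a_def b_def)
  have r: "real (a + 1) = real k + real i" "real (a + b + 2) = real n + real k + 1"
    "real (a + b + 3) = real n + real k + 2" "real (2 * n - (a + b)) = real n + 1 - real k"
    "real (2 * i - 2 + k) + 1 = 2 * real i + real k - 1"
  proof -
    have "a + 1 = k + i" "a + b + 1 = n + k" "2 * n - (a + b) + k = n + 1" "2 * i - 2 + k + 2 = 2 * i + k"
      using assms by (auto simp: a_def b_def)
    then show "real (a + 1) = real k + real i" "real (a + b + 2) = real n + real k + 1"
      "real (a + b + 3) = real n + real k + 2" "real (2 * n - (a + b)) = real n + 1 - real k"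
      "real (2 * i - 2 + k) + 1 = 2 * real i + real k - 1" by linarith+
  qed
  have k8: "8 * real k \<le> real n" "real i \<le> real n" "real i \<ge> 1" "real k \<ge> 3" using assms by auto
  have "(\<Sum>cs\<in>configs_at n k. (real (cs ! (2 * i - 1)))\<^sup>2)
     \<le> (\<Sum>u\<le>2 * n. real (order_stat_weight (2 * n) a b u) * (real (2 * i - 2 + k) - real u)\<^sup>2)"
    unfolding a_def b_def
    by (rule sum_squares_le_shifted_weights[OF finite_configs_at card_configs_at_even_place_le[OF assms(1,3,4)]])
  also have "\<dots> \<le> real (Suc (2 * n) choose Suc (a + b)) * (2 * (4 * real n) + 2 * (2 * real k)\<^sup>2)"
  proof (rule order_stat_second_moment)
    show "a + b \<le> 2 * n" using assms by (simp add: ab)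
    have "(real k + real i) * real (2 * n + 2) * (real n + 1 - real k)
        \<le> (real n + real k + 1) * (4 * real n) * (real n + real k + 2)"
      using k8 by (intro mult_mono) auto
    also have "\<dots> = 4 * real n * ((real n + real k + 1) * (real n + real k + 2))" by (simp only: mult_ac)
    finally show "real (a + 1) * real (2 * n + 2) * real (2 * n - (a + b)) / (real (a + b + 2) * real (a + b + 3))
      \<le> 4 * real n"
      unfolding r by (rule pos_divide_le_eq[THEN iffD2, rotated]) (use k8 in auto)
    have pos: "real n + real k + 1 > 0" by simp
    define Y where "Y = (real k + real i) * real (2 * n + 2) / (real n + real k + 1)"
    define X where "X = 2 * (real k + real i) * real k / (real n + real k + 1)"
    have "Y = 2 * (real k + real i) - X"
      using pos unfolding X_def Y_def by (simp add: field_simps)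
    moreover have "0 \<le> X" by (simp add: X_def)
    moreover have "X \<le> 2 * real k"
      unfolding X_def
    proof (subst pos_divide_le_eq[OF pos])
      have "2 * (real k + real i) * real k \<le> 2 * (real n + real k + 1) * real k"
        using k8 by (intro mult_right_mono) auto
      then show "2 * (real k + real i) * real k \<le> 2 * real k * (real n + real k + 1)" by (simp add: mult_ac)
    qed
    ultimately show "\<bar>real (a + 1) * real (2 * n + 2) / real (a + b + 2) - (real (2 * i - 2 + k) + 1)\<bar> \<le> 2 * real k"
      unfolding r Y_def[symmetric] using k8 by (simp add: abs_le_iff)
  qed
  also have "real (Suc (2 * n) choose Suc (a + b)) = real (card (configs_at n k))"
  proof -
    have "(2 * n + 1) choose (n + 1 - k) = (2 * n + 1) choose (n + k)"
      using assms by (subst binomial_symmetric) auto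
    then show ?thesis using card_configs_at[OF assms(1), of n] assms unfolding ab(2) by simp
  qed
  finally show ?thesis .
qed

lemma sum_configs_at_squares_le:
  assumes "k \<ge> 3" "8 * k \<le> n"
  shows "(\<Sum>cs\<in>configs_at n k. \<Sum>r<2 * n. (real (cs ! r))\<^sup>2)
    \<le> real (card (configs_at n k)) * (16 * real n * (real n + (real k)\<^sup>2))"
proof -
  have "(\<Sum>cs\<in>configs_at n k. (real (cs ! r))\<^sup>2)
      \<le> real (card (configs_at n k)) * (8 * (real n + (real k)\<^sup>2))" if r: "r < 2 * n" for r
  proof (cases "even r")
    case True
    then obtain i where i: "r = 2 * i" by (elim evenE)
    show ?thesis
    proof (cases "i = 0")
      case True
      have "cs ! 0 = k" if "cs \<in> configs_at n k" for cs
        using that by (auto simp: configs_at_def configs_def)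
      then have "(\<Sum>cs\<in>configs_at n k. (real (cs ! r))\<^sup>2) = real (card (configs_at n k)) * (real k)\<^sup>2"
        using True i by simp
      also have "\<dots> \<le> real (card (configs_at n k)) * (8 * (real n + (real k)\<^sup>2))"
        by (intro mult_left_mono) auto
      finally show ?thesis .
    next
      case False
      then show ?thesis using second_moment_odd_place[OF assms, of i] i r
        by (simp add: algebra_simps power2_eq_square)
    qed
  next
    case False
    then obtain i where i: "r = 2 * i + 1" by (elim oddE)
    then show ?thesis using second_moment_even_place[OF assms, of "i + 1"] r
        by (simp add: algebra_simps power2_eq_square)
  qed
  then have "(\<Sum>r<2 * n. \<Sum>cs\<in>configs_at n k. (real (cs ! r))\<^sup>2)
      \<le> (\<Sum>r<2 * n. real (card (configs_at n k)) * (8 * (real n + (real k)\<^sup>2)))"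
    by (intro sum_mono) auto
  then show ?thesis by (subst sum.swap) (simp add: algebra_simps)
qed

lemma markov_card:
  fixes f :: "'a \<Rightarrow> real"
  assumes "finite A" "\<And>x. x \<in> A \<Longrightarrow> f x \<ge> 0" "(\<Sum>x\<in>A. f x) \<le> real (card A) * m" "m > 0"
  shows "real (card A) \<le> 2 * real (card {x \<in> A. f x \<le> 2 * m})"
proof -
  let ?G = "{x \<in> A. f x \<le> 2 * m}" and ?B = "{x \<in> A. \<not> f x \<le> 2 * m}"
  have "real (card ?B) * (2 * m) = (\<Sum>x\<in>?B. 2 * m)" by simp
  also have "\<dots> \<le> (\<Sum>x\<in>?B. f x)" by (intro sum_mono) auto
  also have "\<dots> \<le> (\<Sum>x\<in>A. f x)" using assms by (intro sum_mono2) auto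
  also have "\<dots> \<le> real (card A) * m" by fact
  finally have "2 * real (card ?B) \<le> real (card A)" using assms(4)
    by (simp flip: mult.assoc)
  moreover have "card A = card ?G + card ?B"
    using assms(1) by (subst card_Un_disjoint[symmetric]) (auto intro!: arg_cong[where f=card])
  ultimately show ?thesis by simp
qed

text \<open>The conditional mean of the sum of squares is at most \<open>80 * n\<^sup>2\<close>; Markov's inequality leaves
  half of the words.\<close>

lemma many_configs_with_small_squares:
  assumes "k \<ge> 3" "8 * k \<le> n" "k\<^sup>2 \<le> 4 * n"
  shows "real (card (configs_at n k))
    \<le> 2 * real (card {cs \<in> configs_at n k. (\<Sum>r<2 * n. (real (cs ! r))\<^sup>2) \<le> 160 * (real n)\<^sup>2})"
proof -
  have "n > 0" using assms by auto
  have "(\<Sum>cs\<in>configs_at n k. \<Sum>r<2 * n. (real (cs ! r))\<^sup>2)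
     \<le> real (card (configs_at n k)) * (80 * (real n)\<^sup>2)"
  proof (rule order.trans[OF sum_configs_at_squares_le[OF assms(1,2)]], rule mult_left_mono)
    have "(real k)\<^sup>2 \<le> 4 * real n" using assms(3) by (metis of_nat_le_iff of_nat_mult of_nat_numeral of_nat_power)
    then have "16 * real n * (real n + (real k)\<^sup>2) \<le> 16 * real n * (real n + 4 * real n)"
      by (intro mult_left_mono) auto
    then show "16 * real n * (real n + (real k)\<^sup>2) \<le> 80 * (real n)\<^sup>2"
      by (simp add: power2_eq_square)
  qed simp
  then show ?thesis
    using markov_card[OF finite_configs_at, of n k "\<lambda>cs. \<Sum>r<2 * n. (real (cs ! r))\<^sup>2" "80 * (real n)\<^sup>2"]
      \<open>n > 0\<close> by (simp add: sum_nonneg)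
qed

section \<open>Words with many large letters\<close>

lemma card_ge_eq_shifted_weights:
  fixes g :: "'a \<Rightarrow> nat"
  assumes "finite A" "\<theta> \<ge> 1" "\<theta> \<le> C"
    and count: "\<And>j. j \<ge> 1 \<Longrightarrow> card {x \<in> A. g x = j} = (if j \<le> C then w (C - j) else 0)"
  shows "card {x \<in> A. \<theta> \<le> g x} = (\<Sum>u\<le>C - \<theta>. w u)"
proof -
  have gC: "g x \<le> C" if "x \<in> A" for x
  proof (rule ccontr)
    assume "\<not> g x \<le> C"
    then have "card {y \<in> A. g y = g x} = 0" using count[of "g x"] by simp
    then show False using that assms(1) by auto
  qed
  have "{x \<in> A. \<theta> \<le> g x} = (\<Union>j\<in>{\<theta>..C}. {x \<in> A. g x = j})" using gC by auto
  also have "card \<dots> = (\<Sum>j\<in>{\<theta>..C}. card {x \<in> A. g x = j})"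
    using assms(1) by (intro card_UN_disjoint) auto
  also have "\<dots> = (\<Sum>j\<in>{\<theta>..C}. w (C - j))"
    using assms(2) by (intro sum.cong refl) (simp add: count)
  also have "\<dots> = (\<Sum>u\<le>C - \<theta>. w u)"
    by (rule sum.reindex_bij_witness[where i="\<lambda>u. C - u" and j="\<lambda>j. C - j"]) (use assms in auto)
  finally show ?thesis .
qed

text \<open>The mean of the letter decreases from \<open>k\<close> only linearly along the word, so it is at
  least \<open>k / 2\<close> on the first fifth.  As \<open>64 * n \<le> k\<^sup>2\<close>, a drop by a further \<open>k / 4\<close> is improbable by
  Chebyshev's inequality.\<close>

lemma odd_place_mostly_large:
  assumes "k \<ge> 3" "8 * k \<le> n" "64 * n \<le> k\<^sup>2" "1 \<le> i" "5 * i \<le> n"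
  shows "3 / 4 * real (card (configs_at n k)) \<le> real (card {cs \<in> configs_at n k. k \<le> 4 * cs ! (2 * i)})"
proof -
  have ik: "i + k \<le> n + 1" "i < n" using assms by auto
  define a b C \<theta> where "a = i - 1" and "b = n + 1 - k - i" and "C = 2 * i - 1 + k" and "\<theta> = (k + 3) div 4"
  define \<mu> where "\<mu> = real (a + 1) * real (2 * n + 2) / real (a + b + 2)"
  let ?w = "order_stat_weight (2 * n) a b"
  have ab: "a + b = n - k" "Suc (a + b) = n + 1 - k" using ik assms by (auto simp: a_def b_def)
  have r: "real (a + 1) = real i" "real (a + b + 2) = real n + 2 - real k"
    "real (a + b + 3) = real n + 3 - real k" "real (2 * n - (a + b)) = real n + real k"
    "real C + 1 = 2 * real i + real k"
  proof -
    have "a + 1 = i" "a + b + k = n" "2 * n - (a + b) = n + k" "C + 1 = 2 * i + k"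
      using ik assms by (auto simp: a_def b_def C_def)
    then show "real (a + 1) = real i" "real (a + b + 2) = real n + 2 - real k"
      "real (a + b + 3) = real n + 3 - real k" "real (2 * n - (a + b)) = real n + real k"
      "real C + 1 = 2 * real i + real k" by linarith+
  qed
  have k8: "8 * real k \<le> real n" "5 * real i \<le> real n" "real i \<ge> 1" "real k \<ge> 3" using assms by auto
  have \<theta>: "1 \<le> \<theta>" "\<theta> \<le> C" "4 * real \<theta> \<le> real k + 3"
    using assms by (auto simp: \<theta>_def C_def)
  have T: "real (card (configs_at n k)) = real (Suc (2 * n) choose Suc (a + b))"
    using card_configs_at[OF assms(1), of n] assms unfolding ab(2) by simp
  \<comment> \<open>The slope is \<open>2 / 5\<close> from \<open>i \<le> n / 5\<close>, divided by \<open>7 / 8\<close> from \<open>k \<le> n / 8\<close>.\<close>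
  have \<mu>: "\<mu> \<le> 2 * real i + 16 / 35 * real k"
  proof -
    have pos: "real n + 2 - real k > 0" using k8 by simp
    define X where "X = 2 * real i * (real k - 1) / (real n + 2 - real k)"
    have "\<mu> = 2 * real i + X"
      using pos unfolding \<mu>_def r X_def by (simp add: field_simps)
    moreover have "X \<le> 16 / 35 * real k"
      unfolding X_def
    proof (subst pos_divide_le_eq[OF pos])
      have "2 * real i * (real k - 1) \<le> 2 / 5 * real n * real k" using k8 by (intro mult_mono[of "2 * real i"]) auto
      also have "\<dots> = 16 / 35 * real k * (7 / 8 * real n)" by simp
      also have "\<dots> \<le> 16 / 35 * real k * (real n + 2 - real k)" using k8 by (intro mult_left_mono) auto
      finally show "2 * real i * (real k - 1) \<le> 16 / 35 * real k * (real n + 2 - real k)" .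
    qed
    ultimately show ?thesis by simp
  qed
  have V: "(\<Sum>u\<le>2 * n. real (?w u) * (real u + 1 - \<mu>)\<^sup>2) \<le> real (Suc (2 * n) choose Suc (a + b)) * real n"
  proof -
    have "real i * real (2 * n + 2) * (real n + real k) = real i * (real (2 * n + 2) * (real n + real k))"
      by (rule mult.assoc)
    also have "\<dots> \<le> 1 / 5 * real n * ((2 * real n + 2) * (9 / 8 * real n))"
    proof (rule mult_mono)
      show "real (2 * n + 2) * (real n + real k) \<le> (2 * real n + 2) * (9 / 8 * real n)"
        using k8 by (intro mult_mono) simp_all
    qed (use k8 in simp_all)
    also have "\<dots> \<le> 1 / 5 * real n * (4 * ((7 / 8 * real n + 2) * (7 / 8 * real n + 3)))"
    proof (rule mult_left_mono)
      have "4 * ((7 / 8 * real n + 2) * (7 / 8 * real n + 3)) - (2 * real n + 2) * (9 / 8 * real n)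
          = 13 / 16 * (real n * real n) + 61 / 4 * real n + 24"
        by (simp add: field_simps)
      moreover have "\<dots> \<ge> 0" by (intro add_nonneg_nonneg mult_nonneg_nonneg) auto
      ultimately show "(2 * real n + 2) * (9 / 8 * real n) \<le> 4 * ((7 / 8 * real n + 2) * (7 / 8 * real n + 3))"
        by linarith
    qed simp
    also have "\<dots> \<le> 1 / 5 * real n * (5 * ((real n + 2 - real k) * (real n + 3 - real k)))"
      using k8 by (intro mult_left_mono mult_mono) auto
    also have "\<dots> = real n * ((real n + 2 - real k) * (real n + 3 - real k))" by simp
    finally have "real (a + 1) * real (2 * n + 2) * real (2 * n - (a + b)) / (real (a + b + 2) * real (a + b + 3))
      \<le> real n"
      unfolding r by (rule pos_divide_le_eq[THEN iffD2, rotated]) (use k8 in auto)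
    then have "real (Suc (2 * n) choose Suc (a + b)) * (real (a + 1) * real (2 * n + 2) * real (2 * n - (a + b)) / (real (a + b + 2) * real (a + b + 3)))
       \<le> real (Suc (2 * n) choose Suc (a + b)) * real n" by (rule mult_left_mono) simp
    moreover have "a + b \<le> 2 * n" by (simp add: ab)
    ultimately show ?thesis using order_stat_variance[of a b "2 * n"] unfolding \<mu>_def by linarith
  qed
  have card: "card {cs \<in> configs_at n k. \<theta> \<le> cs ! (2 * i)} = (\<Sum>u\<le>C - \<theta>. ?w u)"
    using card_configs_at_odd_place[OF assms(1,4) ik(2,1)]
    by (intro card_ge_eq_shifted_weights[OF finite_configs_at \<theta>(1,2)]) (simp add: a_def b_def C_def)
  have "real (\<Sum>u\<in>{C - \<theta><..2 * n}. ?w u) * ((real k)\<^sup>2 / 16)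
      = (\<Sum>u\<in>{C - \<theta><..2 * n}. real (?w u) * (real k / 4)\<^sup>2)"
    by (simp add: sum_distrib_right power_divide)
  also have "\<dots> \<le> (\<Sum>u\<in>{C - \<theta><..2 * n}. real (?w u) * (real u + 1 - \<mu>)\<^sup>2)"
  proof (intro sum_mono mult_left_mono power_mono)
    fix u assume "u \<in> {C - \<theta><..2 * n}"
    then have "C + 1 \<le> \<theta> + u" by auto
    then have "real C + 1 \<le> real \<theta> + real u" by linarith
    then show "real k / 4 \<le> real u + 1 - \<mu>" using \<mu> \<theta>(3) r(5) k8 by linarith
  qed (use k8 in auto)
  also have "\<dots> \<le> (\<Sum>u\<le>2 * n. real (?w u) * (real u + 1 - \<mu>)\<^sup>2)"
    by (intro sum_mono2) auto
  also have "\<dots> \<le> real (card (configs_at n k)) * real n" using V T by simp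
  also have "\<dots> \<le> real (card (configs_at n k)) * ((real k)\<^sup>2 / 64)"
  proof (rule mult_left_mono)
    have "64 * real n \<le> (real k)\<^sup>2"
      using assms(3) by (metis of_nat_le_iff of_nat_mult of_nat_numeral of_nat_power)
    then show "real n \<le> (real k)\<^sup>2 / 64" by simp
  qed simp
  also have "\<dots> = 1 / 4 * real (card (configs_at n k)) * ((real k)\<^sup>2 / 16)" by simp
  finally have bad: "real (\<Sum>u\<in>{C - \<theta><..2 * n}. ?w u) \<le> 1 / 4 * real (card (configs_at n k))"
    using k8 by (subst (asm) mult_le_cancel_right_pos) auto
  have "C \<le> 2 * n" using assms by (simp add: C_def)
  then have "{..2 * n} = {..C - \<theta>} \<union> {C - \<theta><..2 * n}" by auto
  then have "(\<Sum>u\<le>2 * n. ?w u) = (\<Sum>u\<le>C - \<theta>. ?w u) + (\<Sum>u\<in>{C - \<theta><..2 * n}. ?w u)"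
    by (metis (no_types, lifting) finite_atMost finite_greaterThanAtMost ivl_disj_int_one(3) sum.union_disjoint)
  then have "real (card (configs_at n k)) = real (card {cs \<in> configs_at n k. \<theta> \<le> cs ! (2 * i)})
      + real (\<Sum>u\<in>{C - \<theta><..2 * n}. ?w u)"
    unfolding T card sum_order_stat_weight by (metis of_nat_add)
  then have "3 / 4 * real (card (configs_at n k)) \<le> real (card {cs \<in> configs_at n k. \<theta> \<le> cs ! (2 * i)})"
    using bad by linarith
  also have "card {cs \<in> configs_at n k. \<theta> \<le> cs ! (2 * i)} = card {cs \<in> configs_at n k. k \<le> 4 * cs ! (2 * i)}"
    unfolding \<theta>_def by (intro arg_cong[where f=card] Collect_cong conj_cong refl) linarith
  finally show ?thesis .
qed

text \<open>Double counting of the pairs of a word and a large letter among the first fifth of the odd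
  places: on average three quarters of these letters are large, hence at least half of them are
  large in a quarter of the words.\<close>

lemma many_configs_with_large_squares:
  assumes "k \<ge> 3" "8 * k \<le> n" "64 * n \<le> k\<^sup>2"
  shows "real (card (configs_at n k))
    \<le> 4 * real (card {cs \<in> configs_at n k. real n * (real k)\<^sup>2 / 320 \<le> (\<Sum>r<2 * n. (real (cs ! r))\<^sup>2)})"
proof -
  define L where "L = n div 5"
  define A where "A = configs_at n k"
  define good where "good cs = card {i \<in> {1..L}. k \<le> 4 * cs ! (2 * i)}" for cs
  define G where "G = {cs \<in> A. real L / 2 \<le> real (good cs)}"
  have fin: "finite A" by (simp add: A_def finite_configs_at)
  have n: "n \<ge> 24" using assms by simp
  have L: "real n / 10 \<le> real L" "real L > 0" using n by (auto simp: L_def)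
  have goodL: "good cs \<le> L" for cs
  proof -
    have "good cs \<le> card {1..L}" unfolding good_def by (rule card_mono) auto
    then show ?thesis by simp
  qed
  have "real L * (3 / 4 * real (card A)) = (\<Sum>i\<in>{1..L}. 3 / 4 * real (card A))" by simp
  also have "\<dots> \<le> (\<Sum>i\<in>{1..L}. real (card {cs \<in> A. k \<le> 4 * cs ! (2 * i)}))"
    using assms unfolding A_def L_def by (intro sum_mono odd_place_mostly_large) auto
  also have "\<dots> = real (\<Sum>i\<in>{1..L}. \<Sum>cs\<in>A. if k \<le> 4 * cs ! (2 * i) then 1 else 0)"
    using fin by (simp add: sum.If_cases Int_def)
  also have "\<dots> = real (\<Sum>cs\<in>A. good cs)"
    unfolding good_def by (subst sum.swap) (simp add: sum.If_cases Int_def)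
  also have "\<dots> \<le> (\<Sum>cs\<in>A. (if cs \<in> G then real L else 0) + real L / 2)"
    unfolding of_nat_sum
  proof (rule sum_mono)
    fix cs assume "cs \<in> A"
    then show "real (good cs) \<le> (if cs \<in> G then real L else 0) + real L / 2"
      using goodL[of cs] L by (auto simp: G_def)
  qed
  also have "\<dots> = real (card G) * real L + real (card A) * (real L / 2)"
  proof -
    have "{cs \<in> A. cs \<in> G} = G" by (auto simp: G_def)
    then show ?thesis using fin by (simp add: sum.distrib sum.If_cases Int_def)
  qed
  finally have "real L * real (card A) \<le> real L * (4 * real (card G))" by (simp add: algebra_simps)
  then have "real (card A) \<le> 4 * real (card G)" using L by simp
  also have "card G \<le> card {cs \<in> A. real n * (real k)\<^sup>2 / 320 \<le> (\<Sum>r<2 * n. (real (cs ! r))\<^sup>2)}"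
  proof (rule card_mono)
    show "G \<subseteq> {cs \<in> A. real n * (real k)\<^sup>2 / 320 \<le> (\<Sum>r<2 * n. (real (cs ! r))\<^sup>2)}"
    proof
      fix cs assume cs: "cs \<in> G"
      let ?I = "{i \<in> {1..L}. k \<le> 4 * cs ! (2 * i)}"
      have "real n * (real k)\<^sup>2 / 320 \<le> real L / 2 * ((real k)\<^sup>2 / 16)"
        using mult_right_mono[OF L(1), of "(real k)\<^sup>2"] by simp
      also have "\<dots> \<le> real (good cs) * ((real k)\<^sup>2 / 16)"
        using cs by (intro mult_right_mono) (auto simp: G_def)
      also have "\<dots> = (\<Sum>i\<in>?I. (real k / 4)\<^sup>2)" by (simp add: good_def power_divide)
      also have "\<dots> \<le> (\<Sum>i\<in>?I. (real (cs ! (2 * i)))\<^sup>2)"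
        by (intro sum_mono power_mono) auto
      also have "\<dots> = (\<Sum>r\<in>(\<lambda>i. 2 * i) ` ?I. (real (cs ! r))\<^sup>2)"
        by (subst sum.reindex) (auto simp: inj_on_def)
      also have "\<dots> \<le> (\<Sum>r<2 * n. (real (cs ! r))\<^sup>2)"
        using n by (intro sum_mono2) (auto simp: L_def)
      finally show "cs \<in> {cs \<in> A. real n * (real k)\<^sup>2 / 320 \<le> (\<Sum>r<2 * n. (real (cs ! r))\<^sup>2)}"
        using cs by (auto simp: G_def)
    qed
  qed (use fin in auto)
  finally show ?thesis unfolding A_def by simp
qed

section \<open>Partitions, beta sets and hook lengths\<close>

lemma initial_segment_eq_lessThan_card:
  fixes S :: "nat set"
  assumes "finite S" "\<And>x y. x \<in> S \<Longrightarrow> y < x \<Longrightarrow> y \<in> S"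
  shows "S = {..<card S}"
proof -
  define m where "m = (LEAST m. m \<notin> S)"
  have m: "m \<notin> S"
    unfolding m_def using ex_new_if_finite[OF infinite_UNIV_nat assms(1)] by (rule LeastI_ex)
  have m': "y \<in> S" if "y < m" for y
    using not_less_Least[of y "\<lambda>m. m \<notin> S"] that by (simp add: m_def)
  have "S = {..<m}"
  proof (rule set_eqI)
    fix x show "x \<in> S \<longleftrightarrow> x \<in> {..<m}"
      using m m'[of x] assms(2)[of x m] by (cases x m rule: linorder_cases) auto
  qed
  then show ?thesis by simp
qed

text \<open>The hook lengths of the first column.\<close>

definition beta_set :: "nat list \<Rightarrow> nat set" where
  "beta_set xs = {xs ! i + (length xs - 1 - i) | i. i < length xs}"

definition closed_under :: "nat \<Rightarrow> nat set \<Rightarrow> bool" where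
  "closed_under h B \<longleftrightarrow> (\<forall>b\<in>B. h \<le> b \<longrightarrow> b - h \<in> B)"

lemma partition_nth_mono:
  assumes "is_partition xs" "i \<le> j" "j < length xs"
  shows "xs ! j \<le> xs ! i"
  using assms unfolding is_partition_def sorted_wrt_iff_nth_less by (metis le_eq_less_or_eq)

text \<open>With rows counted from 0, the rows that reach column \<open>j\<close> form an initial segment.\<close>

lemma less_conjugate_part_iff:
  assumes "is_partition xs" "j \<ge> 1" "i < length xs"
  shows "i < conjugate_part xs j \<longleftrightarrow> j \<le> xs ! i"
proof -
  define S where "S = {i. i < length xs \<and> j \<le> xs ! i}"
  have "S = {..<card S}"
  proof (rule initial_segment_eq_lessThan_card)
    fix x y assume "x \<in> S" "y < x"
    then show "y \<in> S" using partition_nth_mono[OF assms(1), of y x] by (auto simp: S_def)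
  qed (simp add: S_def)
  moreover have "{i. (i, j) \<in> ferrers xs} = Suc ` S"
  proof (rule set_eqI)
    fix i show "i \<in> {i. (i, j) \<in> ferrers xs} \<longleftrightarrow> i \<in> Suc ` S"
      using assms(2) by (cases i) (auto simp: ferrers_def part_def S_def)
  qed
  then have "conjugate_part xs j = card S" by (simp add: conjugate_part_def card_image)
  ultimately have "i < conjugate_part xs j \<longleftrightarrow> i \<in> S" by auto
  then show ?thesis using assms(3) by (simp add: S_def)
qed

lemma conjugate_part_le_length: "conjugate_part xs j \<le> length xs"
proof -
  have "{i. (i, j) \<in> ferrers xs} \<subseteq> {1..length xs}" by (auto simp: ferrers_def)
  then have "card {i. (i, j) \<in> ferrers xs} \<le> card {1..length xs}" by (intro card_mono) auto
  then show ?thesis by (simp add: conjugate_part_def)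
qed

text \<open>The hook lengths in the row with first-column hook length \<open>b\<close> are the differences \<open>b - g\<close>,
  where \<open>g\<close> runs through the numbers below \<open>b\<close> that are not in the beta set; the column \<open>j\<close> belongs to
  \<open>g = j + k - 1 - a\<close>, where \<open>k\<close> is the number of rows and \<open>a\<close> the length of the column.\<close>

lemma hook_exists_iff:
  assumes "is_partition xs" "h \<ge> 1"
  shows "(\<exists>(i, j) \<in> ferrers xs. hook_length xs i j = int h)
     \<longleftrightarrow> (\<exists>b\<in>beta_set xs. h \<le> b \<and> b - h \<notin> beta_set xs)"
proof
  define k where "k = length xs"
  assume "\<exists>(i, j) \<in> ferrers xs. hook_length xs i j = int h"
  then obtain i' j where ij': "(i', j) \<in> ferrers xs" "hook_length xs i' j = int h" by auto
  then obtain i where "i' = Suc i" by (cases i') (auto simp: ferrers_def)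
  then have ij: "(Suc i, j) \<in> ferrers xs" "hook_length xs (Suc i) j = int h" using ij' by auto
  then have i: "i < k" and j: "1 \<le> j" "j \<le> xs ! i" by (auto simp: ferrers_def part_def k_def)
  define a where "a = conjugate_part xs j"
  have a: "a \<le> k" by (simp add: a_def k_def conjugate_part_le_length)
  have ia: "i < a" using less_conjugate_part_iff[OF assms(1) j(1)] i j by (simp add: a_def k_def)
  define g where "g = j + k - 1 - a"
  have h: "xs ! i + (k - 1 - i) = h + g"
    using ij(2) a ia i j by (simp add: hook_length_def part_def g_def flip: a_def)
  have "g \<notin> beta_set xs"
  proof
    assume "g \<in> beta_set xs"
    then obtain i' where i': "i' < k" "g = xs ! i' + (k - 1 - i')" by (auto simp: beta_set_def k_def)
    show False
    proof (cases "i' < a")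
      case True
      then have "j \<le> xs ! i'" using less_conjugate_part_iff[OF assms(1) j(1)] i' by (simp add: a_def k_def)
      then show False using i' True a j by (simp add: g_def)
    next
      case False
      then have "xs ! i' < j" using less_conjugate_part_iff[OF assms(1) j(1)] i' by (simp add: a_def k_def)
      then show False using i' False a j by (simp add: g_def)
    qed
  qed
  moreover have "h + g \<in> beta_set xs" unfolding h[symmetric] beta_set_def using i unfolding k_def by blast
  ultimately show "\<exists>b\<in>beta_set xs. h \<le> b \<and> b - h \<notin> beta_set xs"
    by (intro bexI[where x="h + g"]) auto
next
  define k where "k = length xs"
  define \<beta> where "\<beta> i = xs ! i + (k - 1 - i)" for i
  assume "\<exists>b\<in>beta_set xs. h \<le> b \<and> b - h \<notin> beta_set xs"
  then obtain i where i: "i < k" "h \<le> \<beta> i" "\<beta> i - h \<notin> beta_set xs"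
    by (auto simp: beta_set_def k_def \<beta>_def)
  define g where "g = \<beta> i - h"
  have g: "g \<noteq> \<beta> i'" if "i' < k" for i'
  proof -
    have "\<beta> i' \<in> beta_set xs" unfolding \<beta>_def beta_set_def k_def using that k_def by blast
    then show ?thesis using i(3) by (auto simp: g_def)
  qed
  have \<beta>_anti: "\<beta> y > \<beta> x" if "y < x" "x < k" for x y
    using partition_nth_mono[OF assms(1), of y x] that by (simp add: \<beta>_def k_def)
  define S where "S = {i'. i' < k \<and> g < \<beta> i'}"
  define a where "a = card S"
  have S: "S = {..<a}"
    unfolding a_def
  proof (rule initial_segment_eq_lessThan_card)
    fix x y assume "x \<in> S" "y < x"
    then show "y \<in> S" using \<beta>_anti[of y x] by (auto simp: S_def)
  qed (simp add: S_def)
  have "i \<in> S" using i assms(2) by (simp add: S_def g_def)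
  then have ia: "i < a" by (simp add: S)
  have a: "a \<le> k"
    unfolding a_def using card_mono[of "{..<k}" S] by (auto simp: S_def)
  have "a - 1 \<in> S" using S ia by auto
  then have ga: "g < xs ! (a - 1) + (k - a)" using a ia by (simp add: S_def \<beta>_def)
  have ga': "xs ! a + (k - 1 - a) < g" if "a < k"
  proof -
    have "a \<notin> S" using S by simp
    then show ?thesis using g[OF that] that by (simp add: S_def \<beta>_def)
  qed
  have gk: "k - a \<le> g"
  proof (cases "a < k")
    case True
    then have "xs ! a > 0" using assms(1) by (auto simp: is_partition_def k_def)
    then show ?thesis using ga'[OF True] True by simp
  qed simp
  \<comment> \<open>The column of the hook: exactly the first \<open>a\<close> rows reach it.\<close>
  define j where "j = g + 1 - (k - a)"
  have j: "1 \<le> j" using gk by (simp add: j_def)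
  have "conjugate_part xs j = a"
  proof (rule antisym)
    have "j \<le> xs ! (a - 1)" using ga gk by (simp add: j_def)
    moreover have "a - 1 < length xs" using ia a by (simp add: k_def)
    ultimately have "a - 1 < conjugate_part xs j"
      using less_conjugate_part_iff[OF assms(1) j] by blast
    then show "a \<le> conjugate_part xs j" by simp
    show "conjugate_part xs j \<le> a"
    proof (cases "a < k")
      case True
      then have "xs ! a < j" using ga'[OF True] gk by (simp add: j_def)
      then show ?thesis using less_conjugate_part_iff[OF assms(1) j, of a] True by (simp add: k_def)
    next
      case False
      then show ?thesis using conjugate_part_le_length[of xs j] a by (simp add: k_def)
    qed
  qed
  moreover have "j \<le> xs ! i"
    using less_conjugate_part_iff[OF assms(1) j, of i] calculation ia i by (simp add: k_def)
  moreover have "int h = int (xs ! i) + int a - int i - int j"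
  proof -
    have "int h = int (\<beta> i) - int g" using i by (simp add: g_def)
    moreover have "int j = int g + 1 - int k + int a" using gk a by (simp add: j_def)
    moreover have "int (\<beta> i) = int (xs ! i) + int k - 1 - int i" using i by (simp add: \<beta>_def)
    ultimately show ?thesis by simp
  qed
  ultimately have "(Suc i, j) \<in> ferrers xs" "hook_length xs (Suc i) j = int h"
    using i j by (auto simp: ferrers_def part_def hook_length_def k_def)
  then show "\<exists>(i, j) \<in> ferrers xs. hook_length xs i j = int h" by blast
qed

lemma is_core_iff_closed_under:
  assumes "s \<ge> 1" "t \<ge> 1"
  shows "is_core s t xs \<longleftrightarrow>
    is_partition xs \<and> closed_under s (beta_set xs) \<and> closed_under t (beta_set xs)"
proof (cases "is_partition xs")
  case True
  have "is_core s t xs \<longleftrightarrow> \<not> (\<exists>(i, j) \<in> ferrers xs. hook_length xs i j = int s)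
      \<and> \<not> (\<exists>(i, j) \<in> ferrers xs. hook_length xs i j = int t)"
    using True by (auto simp: is_core_def)
  then show ?thesis
    unfolding hook_exists_iff[OF True assms(1)] hook_exists_iff[OF True assms(2)]
    using True by (auto simp: closed_under_def)
qed (simp add: is_core_def)

text \<open>The beta sets of partitions with distinct parts: the difference of neighbouring elements
  exceeds that of the corresponding parts by one.\<close>

definition sparse :: "nat set \<Rightarrow> bool" where
  "sparse B \<longleftrightarrow> finite B \<and> 0 \<notin> B \<and> (\<forall>b\<in>B. Suc b \<notin> B)"

text \<open>The inverse of \<open>beta_set\<close>; the largest element belongs to the first part.\<close>

definition partition_of :: "nat set \<Rightarrow> nat list" where
  "partition_of B = map (\<lambda>i. sorted_list_of_set B ! (card B - 1 - i) - (card B - 1 - i)) [0..<card B]"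

lemma sparse_sorted_list_nth:
  assumes "sparse B" "i < j" "j < card B"
  shows "sorted_list_of_set B ! i + 2 \<le> sorted_list_of_set B ! j"
proof -
  let ?as = "sorted_list_of_set B"
  have fin: "finite B" using assms by (simp add: sparse_def)
  have "?as ! i < ?as ! j"
    using sorted_wrt_nth_less[OF strict_sorted_list_of_set[of B] assms(2)] assms(3) by simp
  moreover have "?as ! i \<in> B" "?as ! j \<in> B"
    using nth_mem[of i ?as] nth_mem[of j ?as] assms fin by auto
  then have "?as ! j \<noteq> Suc (?as ! i)" using assms(1) by (metis sparse_def)
  ultimately show ?thesis by simp
qed

lemma sparse_sorted_list_nth_ge:
  assumes "sparse B" "i < card B"
  shows "i < sorted_list_of_set B ! i"
  using assms(2)
proof (induction i)
  case 0
  have "sorted_list_of_set B ! 0 \<in> B"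
    using 0 assms nth_mem[of 0 "sorted_list_of_set B"] by (simp add: sparse_def)
  then show ?case using assms by (metis sparse_def gr0I)
next
  case (Suc i)
  then show ?case using sparse_sorted_list_nth[OF assms(1), of i "Suc i"] by simp
qed

lemma nth_partition_of:
  assumes "sparse B" "i < card B"
  shows "partition_of B ! i + (card B - 1 - i) = sorted_list_of_set B ! (card B - 1 - i)"
  using assms sparse_sorted_list_nth_ge[OF assms(1), of "card B - 1 - i"]
  by (simp add: partition_of_def)

lemma length_partition_of: "length (partition_of B) = card B"
  by (simp add: partition_of_def)

lemma partition_of_strict:
  assumes "sparse B" "i < j" "j < card B"
  shows "partition_of B ! j < partition_of B ! i"
proof -
  have "sorted_list_of_set B ! (card B - 1 - j) + (j - i) < sorted_list_of_set B ! (card B - 1 - i)"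
    using assms(2,3)
  proof (induction j)
    case (Suc j)
    have step: "sorted_list_of_set B ! (card B - 1 - Suc j) + 2 \<le> sorted_list_of_set B ! (card B - 1 - j)"
      by (rule sparse_sorted_list_nth[OF assms(1)]) (use Suc.prems in linarith)+
    show ?case
    proof (cases "i = j")
      case True
      then show ?thesis
        using step by simp
    next
      case False
      then have "sorted_list_of_set B ! (card B - 1 - j) + (j - i) < sorted_list_of_set B ! (card B - 1 - i)"
        using Suc by simp
      then show ?thesis
        using step Suc.prems by simp
    qed
  qed simp
  then show ?thesis
    using nth_partition_of[OF assms(1), of i] nth_partition_of[OF assms(1), of j] assms by simp
qed

lemma partition_of_is_distinct_partition:
  assumes "sparse B"
  shows "is_partition (partition_of B)" "distinct (partition_of B)"
proof -
  have "0 < partition_of B ! i" if "i < card B" for i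
    using nth_partition_of[OF assms that] sparse_sorted_list_nth_ge[OF assms, of "card B - 1 - i"] that
    by simp
  then show "is_partition (partition_of B)"
    unfolding is_partition_def sorted_wrt_iff_nth_less
    using partition_of_strict[OF assms] by (auto simp: length_partition_of in_set_conv_nth less_imp_le)
  show "distinct (partition_of B)"
    unfolding distinct_conv_nth length_partition_of
    using partition_of_strict[OF assms] by (force simp: neq_iff)
qed

lemma beta_set_partition_of:
  assumes "sparse B"
  shows "beta_set (partition_of B) = B"
proof -
  have fin: "finite B" using assms by (simp add: sparse_def)
  have "beta_set (partition_of B) = {sorted_list_of_set B ! (card B - 1 - i) | i. i < card B}"
    unfolding beta_set_def length_partition_of setcompr_eq_image
    by (intro image_cong refl nth_partition_of[OF assms]) simp
  also have "\<dots> = {sorted_list_of_set B ! i | i. i < card B}"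
  proof safe
    fix i assume "i < card B"
    then show "\<exists>i'. sorted_list_of_set B ! i = sorted_list_of_set B ! (card B - 1 - i') \<and> i' < card B"
      by (intro exI[of _ "card B - 1 - i"]) auto
  next
    fix i assume "i < card B"
    then have "card B - 1 - i < card B" by simp
    then show "\<exists>i'. sorted_list_of_set B ! (card B - 1 - i) = sorted_list_of_set B ! i' \<and> i' < card B"
      by blast
  qed
  also have "\<dots> = set (sorted_list_of_set B)" by (auto simp: set_conv_nth)
  finally show ?thesis using fin by simp
qed

lemma distinct_partition_nth_strict:
  assumes "is_partition xs" "distinct xs" "i < j" "j < length xs"
  shows "xs ! j < xs ! i"
  using partition_nth_mono[OF assms(1), of i j] assms nth_eq_iff_index_eq[of xs i j] by fastforce

lemma sparse_beta_set:
  assumes "is_partition xs" "distinct xs"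
  shows "sparse (beta_set xs)"
proof -
  have "finite (beta_set xs)" by (simp add: beta_set_def)
  moreover have "0 \<notin> beta_set xs"
  proof
    assume "0 \<in> beta_set xs"
    then obtain i where "i < length xs" "xs ! i = 0" by (auto simp: beta_set_def)
    then show False using assms(1) nth_mem[of i xs] by (auto simp: is_partition_def)
  qed
  moreover have "Suc b \<notin> beta_set xs" if "b \<in> beta_set xs" for b
  proof
    assume "Suc b \<in> beta_set xs"
    then obtain i j where ij: "i < length xs" "j < length xs" "b = xs ! i + (length xs - 1 - i)"
      "Suc b = xs ! j + (length xs - 1 - j)" using \<open>b \<in> _\<close> by (auto simp: beta_set_def)
    show False
    proof (cases i j rule: linorder_cases)
      case less
      then show False using distinct_partition_nth_strict[OF assms less ij(2)] ij by simp
    next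
      case greater
      then show False using distinct_partition_nth_strict[OF assms greater ij(1)] ij by simp
    qed (use ij in simp)
  qed
  ultimately show ?thesis by (simp add: sparse_def)
qed

lemma partition_of_beta_set:
  assumes "is_partition xs" "distinct xs"
  shows "partition_of (beta_set xs) = xs"
proof -
  define k where "k = length xs"
  define as where "as = map (\<lambda>i. xs ! (k - 1 - i) + i) [0..<k]"
  have "sorted_wrt (<) as"
    unfolding sorted_wrt_iff_nth_less
  proof (intro allI impI)
    fix i j assume "i < j" "j < length as"
    moreover from this have "xs ! (k - 1 - i) \<le> xs ! (k - 1 - j)"
      unfolding as_def k_def by (intro partition_nth_mono[OF assms(1)]) auto
    ultimately show "as ! i < as ! j" by (simp add: as_def)
  qed
  moreover have "set as = beta_set xs"
  proof -
    have "set as = (\<lambda>i. xs ! (k - 1 - i) + i) ` {..<k}" by (auto simp: as_def)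
    also have "\<dots> = (\<lambda>i. xs ! i + (k - 1 - i)) ` {..<k}"
    proof (rule set_eqI, rule iffI)
      fix x assume "x \<in> (\<lambda>i. xs ! (k - 1 - i) + i) ` {..<k}"
      then obtain i where "i < k" "x = xs ! (k - 1 - i) + i" by auto
      then show "x \<in> (\<lambda>i. xs ! i + (k - 1 - i)) ` {..<k}"
        by (intro image_eqI[where x="k - 1 - i"]) auto
    next
      fix x assume "x \<in> (\<lambda>i. xs ! i + (k - 1 - i)) ` {..<k}"
      then obtain i where "i < k" "x = xs ! i + (k - 1 - i)" by auto
      then show "x \<in> (\<lambda>i. xs ! (k - 1 - i) + i) ` {..<k}"
        by (intro image_eqI[where x="k - 1 - i"]) auto
    qed
    finally show ?thesis unfolding beta_set_def k_def by blast
  qed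
  ultimately have as: "sorted_list_of_set (beta_set xs) = as"
    using sorted_list_of_set.idem_if_sorted_distinct[of as] by (simp add: strict_sorted_iff)
  then have "card (beta_set xs) = k" using length_sorted_list_of_set[of "beta_set xs"] by (simp add: as_def)
  then show ?thesis unfolding partition_of_def as
    by (intro nth_equalityI) (auto simp: as_def k_def)
qed

lemma sum_partition_of:
  assumes "sparse B"
  shows "real (sum_list (partition_of B)) = real (\<Sum>B) - real (card B) * (real (card B) - 1) / 2"
proof -
  let ?k = "card B" and ?as = "sorted_list_of_set B"
  have "sum_list (partition_of B) + (\<Sum>i<?k. ?k - 1 - i)
      = (\<Sum>i<?k. partition_of B ! i + (?k - 1 - i))"
    by (simp only: sum_list_sum_nth length_partition_of sum.distrib lessThan_atLeast0)
  also have "\<dots> = (\<Sum>i<?k. ?as ! (?k - 1 - i))"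
    using nth_partition_of[OF assms] by (intro sum.cong) auto
  also have "\<dots> = (\<Sum>i<?k. ?as ! i)"
    using sum.nat_diff_reindex[of "\<lambda>i. ?as ! i" ?k] by simp
  also have "\<dots> = sum_list ?as" by (simp add: sum_list_sum_nth lessThan_atLeast0)
  also have "\<dots> = \<Sum>B"
    using assms sum_list_distinct_conv_sum_set[of ?as "\<lambda>x. x"] by (simp add: sparse_def)
  finally have "sum_list (partition_of B) + (\<Sum>i<?k. ?k - 1 - i) = \<Sum>B" .
  moreover have "(\<Sum>i<?k. ?k - 1 - i) = (\<Sum>i<?k. i)"
    using sum.nat_diff_reindex[of "\<lambda>i. i" ?k] by simp
  moreover have "real (\<Sum>i<k. i) = real k * (real k - 1) / 2" for k
    by (induction k) (auto simp: field_simps)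
  ultimately show ?thesis by (metis add_diff_cancel_right' of_nat_add)
qed

section \<open>Cores as words\<close>

text \<open>Index form of the local rules, with the state prepended to the word.\<close>

lemma valid_path_iff_nth:
  "valid_path a b xs \<longleftrightarrow> (\<forall>r<length xs. (a # b # xs) ! (r + 2) \<le> Suc ((a # b # xs) ! r) \<and>
     ((a # b # xs) ! (r + 1) = 0 \<or> (a # b # xs) ! (r + 2) = 0))"
proof (induction xs arbitrary: a b)
  case (Cons x xs)
  show ?case
    unfolding valid_path.simps Cons.IH length_Cons All_less_Suc2
    by simp
qed simp

definition step_conditions :: "nat \<Rightarrow> (nat \<Rightarrow> nat) \<Rightarrow> bool" where
  "step_conditions n c \<longleftrightarrow>
     (\<forall>r<2 * n - 1. c (r + 2) \<le> Suc (c r) \<and> (c (r + 1) = 0 \<or> c (r + 2) = 0)) \<and>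
     c 1 \<le> c (2 * n) + 2"

lemma step_conditionsD:
  assumes "step_conditions n c"
  shows "r < 2 * n - 1 \<Longrightarrow> c (r + 2) \<le> Suc (c r)"
    "r < 2 * n - 1 \<Longrightarrow> c (r + 1) = 0 \<or> c (r + 2) = 0"
    "c 1 \<le> c (2 * n) + 2"
  using assms by (auto simp: step_conditions_def)

lemma configs_iff_step_conditions:
  assumes "n \<ge> 1"
  shows "cs \<in> configs n \<longleftrightarrow> length cs = 2 * n \<and> step_conditions n (\<lambda>r. (0 # cs) ! r)"
proof (cases "length cs = 2 * n")
  case True
  then obtain k ys where cs: "cs = k # ys" using assms by (cases cs) auto
  then have "length ys = 2 * n - 1" using True by simp
  moreover have "last cs = (0 # cs) ! (2 * n)"
  proof -
    have "last cs = cs ! (2 * n - 1)" using True cs by (metis last_conv_nth list.distinct(1))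
    then show ?thesis using assms by (simp add: nth_Cons')
  qed
  ultimately show ?thesis
    using True unfolding cs configs_def step_conditions_def by (auto simp: valid_path_iff_nth)
qed (simp add: configs_def)

text \<open>Every residue class contains an initial segment, as it must in a set closed under subtraction
  of \<open>s\<close>.\<close>

definition residue_set :: "nat \<Rightarrow> (nat \<Rightarrow> nat) \<Rightarrow> nat set" where
  "residue_set s c = {b. b div s < c (b mod s)}"

lemma mem_residue_set:
  assumes "r < s"
  shows "s * m + r \<in> residue_set s c \<longleftrightarrow> m < c r"
  using assms by (simp add: residue_set_def)

lemma residue_set_eq_image:
  assumes "s \<ge> 1"
  shows "residue_set s c = (\<lambda>(r, m). s * m + r) ` (SIGMA r:{..<s}. {..<c r})"
proof (rule set_eqI, rule iffI)
  fix b assume "b \<in> residue_set s c"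
  then show "b \<in> (\<lambda>(r, m). s * m + r) ` (SIGMA r:{..<s}. {..<c r})"
    using assms by (intro image_eqI[where x="(b mod s, b div s)"]) (auto simp: residue_set_def)
qed (auto simp: residue_set_def)

lemma inj_on_residue_decomposition:
  "inj_on (\<lambda>(r, m). s * m + r) (SIGMA r:{..<s}. {..<c r :: nat})" for s :: nat
proof (rule inj_onI, clarsimp)
  fix r m r' m' assume *: "r < s" "r' < s" "s * m + r = s * m' + r'"
  have "(s * m + r) mod s = r" "(s * m + r) div s = m" using *(1) by auto
  moreover have "(s * m' + r') mod s = r'" "(s * m' + r') div s = m'" using *(2) by auto
  ultimately show "r = r' \<and> m = m'" using *(3) by metis
qed

lemma finite_residue_set: "s \<ge> 1 \<Longrightarrow> finite (residue_set s c)"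
  by (simp add: residue_set_eq_image)

lemma card_residue_set: "s \<ge> 1 \<Longrightarrow> card (residue_set s c) = (\<Sum>r<s. c r)"
  by (simp add: residue_set_eq_image card_image inj_on_residue_decomposition)

lemma sum_residue_set: "s \<ge> 1 \<Longrightarrow> \<Sum>(residue_set s c) = (\<Sum>r<s. \<Sum>m<c r. s * m + r)"
  unfolding residue_set_eq_image
  by (subst sum.reindex[OF inj_on_residue_decomposition]) (simp add: sum.Sigma split_def)

lemma residue_set_closed_step:
  assumes "s \<ge> 1"
  shows "closed_under s (residue_set s c)"
  unfolding closed_under_def
proof (intro ballI impI)
  fix b assume b: "b \<in> residue_set s c" "s \<le> b"
  then have "(b - s) mod s = b mod s" "(b - s) div s \<le> b div s"
    by (auto simp: le_mod_geq div_le_mono)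
  then show "b - s \<in> residue_set s c" using b by (auto simp: residue_set_def)
qed

text \<open>Subtracting \<open>s + 2\<close> from \<open>s * m + r\<close> leads to level \<open>m - 1\<close> of the class \<open>r - 2\<close>, hence
  \<open>c r \<le> c (r - 2) + 1\<close>.  From the class 1 it leads to level \<open>m - 2\<close> of the class \<open>s - 1\<close>, which gives
  the weaker condition at the two ends of the word.\<close>

lemma step_conditions_iff:
  assumes "n \<ge> 1" "c 0 = 0"
  defines "s \<equiv> 2 * n + 1"
  shows "step_conditions n c \<longleftrightarrow>
    sparse (residue_set s c) \<and> closed_under (s + 2) (residue_set s c)"
proof
  let ?B = "residue_set s c"
  assume *: "step_conditions n c"
  have s: "s \<ge> 3" using assms by simp
  have "closed_under (s + 2) ?B"
    unfolding closed_under_def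
  proof (intro ballI impI)
    fix b assume b: "b \<in> ?B" "s + 2 \<le> b"
    define r m where "r = b mod s" and "m = b div s"
    have e: "b = s * m + r" by (simp add: r_def m_def)
    have r: "r < s" using s by (simp add: r_def)
    have m: "m < c r" using b(1) by (simp add: residue_set_def r_def m_def)
    then have "r \<noteq> 0" using assms(2) by (intro notI) simp
    then have "r = 1 \<or> (\<exists>r'. r = r' + 2)" by presburger
    then consider "r = 1" | r' where "r = r' + 2" by blast
    then show "b - (s + 2) \<in> ?B"
    proof cases
      case 1
      have "\<not> m \<le> 1"
      proof
        assume "m \<le> 1"
        then have "s * m \<le> s" using mult_le_mono2[of m 1 s] by (simp only: mult_1_right)
        then show False using b(2) e 1 by linarith
      qed
      then have "\<exists>m'. m = m' + 2" by presburger
      then obtain m' where m': "m = m' + 2" by blast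
      have "b - (s + 2) = s * m' + 2 * n" using e 1 m' by (simp add: s_def algebra_simps)
      moreover have "m' < c (2 * n)" using * m m' 1 by (simp add: step_conditions_def)
      ultimately show ?thesis using mem_residue_set[of "2 * n" s m' c] by (simp add: s_def)
    next
      case 2
      have "m \<noteq> 0" using b(2) e r by (intro notI) simp
      then obtain m' where m': "m = Suc m'" by (cases m) auto
      have "b - (s + 2) = s * m' + r'" using e 2 m' by simp
      moreover have "r' < 2 * n - 1" using r 2 by (simp add: s_def)
      then have "c (r' + 2) \<le> Suc (c r')" by (rule step_conditionsD[OF *])
      then have "m' < c r'" using m m' 2 by simp
      ultimately show ?thesis using mem_residue_set[of r' s m' c] r 2 by simp
    qed
  qed
  moreover have "sparse ?B"
    unfolding sparse_def
  proof (intro conjI ballI)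
    show "finite ?B" using s by (intro finite_residue_set) simp
    show "0 \<notin> ?B" by (simp add: residue_set_def assms(2))
    fix b assume b: "b \<in> ?B"
    define r m where "r = b mod s" and "m = b div s"
    have e: "b = s * m + r" by (simp add: r_def m_def)
    have r: "r < s" using s by (simp add: r_def)
    have m: "m < c r" using b(1) by (simp add: residue_set_def r_def m_def)
    show "Suc b \<notin> ?B"
    proof (cases "Suc r = s")
      case True
      have "Suc b = s * Suc m + 0" using e True by simp
      then show ?thesis using mem_residue_set[of 0 s "Suc m" c] s assms(2) by simp
    next
      case False
      have "r \<noteq> 0" using m assms(2) by (intro notI) simp
      then obtain r' where r': "r = Suc r'" by (cases r) auto
      then have "r' < 2 * n - 1" using r False by (simp add: s_def)
      then have "c (r' + 1) = 0 \<or> c (r' + 2) = 0" by (rule step_conditionsD[OF *])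
      then have "c r = 0 \<or> c (Suc r) = 0" by (simp add: r')
      then have "c (Suc r) = 0" using m by simp
      moreover have "Suc b = s * m + Suc r" using e by simp
      ultimately show ?thesis using mem_residue_set[of "Suc r" s m c] r False by simp
    qed
  qed
  ultimately show "sparse ?B \<and> closed_under (s + 2) ?B" by blast
next
  let ?B = "residue_set s c"
  assume "sparse ?B \<and> closed_under (s + 2) ?B"
  then have sp: "sparse ?B" and cl: "closed_under (s + 2) ?B" by auto
  have s: "s \<ge> 3" using assms by simp
  have 1: "c (r + 2) \<le> Suc (c r)" if r: "r < 2 * n - 1" for r
  proof (rule ccontr)
    assume "\<not> ?thesis"
    then have "s * Suc (c r) + (r + 2) \<in> ?B"
      using mem_residue_set[of "r + 2" s "Suc (c r)" c] r by (simp add: s_def)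
    then have "s * Suc (c r) + (r + 2) - (s + 2) \<in> ?B" using cl by (auto simp: closed_under_def)
    then have "s * c r + r \<in> ?B" by simp
    moreover have "r < s" using r by (simp add: s_def)
    ultimately show False using mem_residue_set[of r s "c r" c] by simp
  qed
  have 2: "c (r + 1) = 0 \<or> c (r + 2) = 0" if r: "r < 2 * n - 1" for r
  proof (rule ccontr)
    assume "\<not> ?thesis"
    then have "s * 0 + (r + 1) \<in> ?B" "s * 0 + (r + 2) \<in> ?B"
      using mem_residue_set[of "r + 1" s 0 c] mem_residue_set[of "r + 2" s 0 c] r by (auto simp: s_def)
    then show False using sp by (auto simp: sparse_def)
  qed
  have 3: "c 1 \<le> c (2 * n) + 2"
  proof (rule ccontr)
    assume "\<not> ?thesis"
    then have "s * (c (2 * n) + 2) + 1 \<in> ?B"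
      using mem_residue_set[of 1 s "c (2 * n) + 2" c] s by simp
    moreover have "s + 2 \<le> s * (c (2 * n) + 2) + 1" using s by (simp add: algebra_simps)
    ultimately have "s * (c (2 * n) + 2) + 1 - (s + 2) \<in> ?B" using cl by (auto simp: closed_under_def)
    moreover have "s * (c (2 * n) + 2) + 1 - (s + 2) = s * c (2 * n) + 2 * n"
      by (simp add: s_def algebra_simps)
    ultimately have "s * c (2 * n) + 2 * n \<in> ?B" by simp
    then show False using mem_residue_set[of "2 * n" s "c (2 * n)" c] by (simp add: s_def)
  qed
  show "step_conditions n c" unfolding step_conditions_def by (intro conjI allI impI 1 2 3)
qed

definition config_set :: "nat \<Rightarrow> nat list \<Rightarrow> nat set" where
  "config_set n cs = residue_set (2 * n + 1) (\<lambda>r. (0 # cs) ! r)"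

definition core_of :: "nat \<Rightarrow> nat list \<Rightarrow> nat list" where
  "core_of n cs = partition_of (config_set n cs)"

lemma sparse_config_set:
  assumes "n \<ge> 1" "cs \<in> configs n"
  shows "sparse (config_set n cs)" "closed_under (2 * n + 1) (config_set n cs)"
    "closed_under (2 * n + 3) (config_set n cs)"
  using assms step_conditions_iff[of n "\<lambda>r. (0 # cs) ! r"] residue_set_closed_step[of "2 * n + 1" "\<lambda>r. (0 # cs) ! r"]
  by (auto simp: configs_iff_step_conditions config_set_def numeral_3_eq_3)

lemma core_of_in_distinct_cores:
  assumes "n \<ge> 1" "cs \<in> configs n"
  shows "core_of n cs \<in> distinct_cores (2 * n + 1) (2 * n + 3)"
proof -
  note sp = sparse_config_set[OF assms]
  show ?thesis
    unfolding distinct_cores_def core_of_def mem_Collect_eq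
    using sp partition_of_is_distinct_partition[OF sp(1)]
    by (subst is_core_iff_closed_under) (auto simp: beta_set_partition_of[OF sp(1)])
qed

lemma inj_on_core_of:
  assumes "n \<ge> 1"
  shows "inj_on (core_of n) (configs n)"
proof (rule inj_onI)
  fix cs ds assume cs: "cs \<in> configs n" and ds: "ds \<in> configs n" and e: "core_of n cs = core_of n ds"
  have "config_set n cs = config_set n ds"
    using arg_cong[OF e, of beta_set] sparse_config_set(1)[OF assms cs] sparse_config_set(1)[OF assms ds]
    by (simp add: core_of_def beta_set_partition_of)
  then have m: "m < (0 # cs) ! r \<longleftrightarrow> m < (0 # ds) ! r" if "r < 2 * n + 1" for r m
    using mem_residue_set[OF that, of m "\<lambda>r. (0 # cs) ! r"]
      mem_residue_set[OF that, of m "\<lambda>r. (0 # ds) ! r"] \<open>config_set n cs = config_set n ds\<close>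
    unfolding config_set_def by metis
  have "length cs = 2 * n" "length ds = 2 * n" using cs ds by (auto simp: configs_def)
  moreover have "cs ! r = ds ! r" if "r < 2 * n" for r
    using m[of "Suc r" "cs ! r"] m[of "Suc r" "ds ! r"] that by simp
  ultimately show "cs = ds" by (intro nth_equalityI) auto
qed

lemma core_of_surj:
  assumes "n \<ge> 1" "xs \<in> distinct_cores (2 * n + 1) (2 * n + 3)"
  shows "xs \<in> core_of n ` configs n"
proof -
  define s where "s = 2 * n + 1"
  define B where "B = beta_set xs"
  have xs: "is_partition xs" "distinct xs" "closed_under s B" "closed_under (s + 2) B"
    using assms is_core_iff_closed_under[of "2 * n + 1" "2 * n + 3" xs]
    by (auto simp: distinct_cores_def s_def B_def numeral_3_eq_3)
  have sp: "sparse B" unfolding B_def by (rule sparse_beta_set[OF xs(1,2)])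
  have s: "s \<ge> 3" using assms by (simp add: s_def)
  define c where "c r = card {m. s * m + r \<in> B}" for r
  have c: "{m. s * m + r \<in> B} = {..<c r}" for r
    unfolding c_def
  proof (rule initial_segment_eq_lessThan_card)
    show "finite {m. s * m + r \<in> B}"
    proof (rule finite_imageD)
      show "finite ((\<lambda>m. s * m + r) ` {m. s * m + r \<in> B})"
        by (rule finite_subset[of _ B]) (use sp in \<open>auto simp: sparse_def\<close>)
      show "inj_on (\<lambda>m. s * m + r) {m. s * m + r \<in> B}" using s by (intro inj_onI) simp
    qed
    fix x y assume "x \<in> {m. s * m + r \<in> B}" "y < x"
    then show "y \<in> {m. s * m + r \<in> B}"
    proof (induction x)
      case (Suc x)
      have "s * Suc x + r - s \<in> B" using xs(3) Suc.prems by (auto simp: closed_under_def)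
      then have "s * x + r \<in> B" by simp
      then show ?case using Suc by (cases "y = x") auto
    qed simp
  qed
  have mem: "s * m + r \<in> B \<longleftrightarrow> m < c r" for m r
    using c[of r] by auto
  have c0: "c 0 = 0" using mem[of 0 0] sp by (simp add: sparse_def)
  have B: "B = residue_set s c"
  proof (rule set_eqI)
    fix b show "b \<in> B \<longleftrightarrow> b \<in> residue_set s c"
      using mem[of "b div s" "b mod s"] by (simp add: residue_set_def)
  qed
  define cs where "cs = map (\<lambda>r. c (Suc r)) [0..<2 * n]"
  have cs: "(0 # cs) ! r = c r" if "r < s" for r
    using that c0 by (cases r) (auto simp: cs_def s_def)
  have "config_set n cs = B"
    unfolding B config_set_def residue_set_def s_def[symmetric] using s cs by simp
  moreover from this have "cs \<in> configs n"
    using assms sp xs(4) step_conditions_iff[of n "\<lambda>r. (0 # cs) ! r"]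
    by (subst configs_iff_step_conditions) (auto simp: config_set_def s_def cs_def)
  ultimately have "xs = core_of n cs"
    using partition_of_beta_set[OF xs(1,2)] by (simp add: core_of_def B_def)
  then show ?thesis using \<open>cs \<in> configs n\<close> by blast
qed

lemma bij_betw_core_of:
  "n \<ge> 1 \<Longrightarrow> bij_betw (core_of n) (configs n) (distinct_cores (2 * n + 1) (2 * n + 3))"
  unfolding bij_betw_def
  by (intro conjI inj_on_core_of subset_antisym image_subsetI subsetI core_of_in_distinct_cores core_of_surj)

lemma psize_core_of:
  assumes "n \<ge> 1" "cs \<in> configs n"
  defines "N \<equiv> real (\<Sum>r<2 * n. cs ! r)"
  shows "psize (core_of n cs) = real (\<Sum>r<2 * n + 1. \<Sum>m<(0 # cs) ! r. (2 * n + 1) * m + r) - N * (N - 1) / 2"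
proof -
  have "real (card (config_set n cs)) = N"
    unfolding config_set_def N_def
    by (subst card_residue_set) (simp_all add: sum.lessThan_Suc_shift del: sum.lessThan_Suc)
  then show ?thesis
    unfolding psize_def core_of_def sum_partition_of[OF sparse_config_set(1)[OF assms(1,2)]]
    by (simp add: config_set_def sum_residue_set)
qed

text \<open>Drop the subtracted triangular number and bound each of the \<open>c\<close> elements in a residue class by \<open>s * c\<close>.\<close>

lemma psize_core_of_le:
  assumes "n \<ge> 1" "cs \<in> configs n"
  shows "psize (core_of n cs) \<le> real (2 * n + 1) * (\<Sum>r<2 * n. (real (cs ! r))\<^sup>2)"
proof -
  let ?N = "\<Sum>r<2 * n. cs ! r"
  have "(\<Sum>r<2 * n + 1. \<Sum>m<(0 # cs) ! r. (2 * n + 1) * m + r)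
      \<le> (\<Sum>r<2 * n + 1. (2 * n + 1) * ((0 # cs) ! r)\<^sup>2)"
  proof (rule sum_mono)
    fix r assume r: "r \<in> {..<2 * n + 1}"
    have "(\<Sum>m<(0 # cs) ! r. (2 * n + 1) * m + r) \<le> (\<Sum>m<(0 # cs) ! r. (2 * n + 1) * ((0 # cs) ! r))"
    proof (rule sum_mono)
      fix m assume "m \<in> {..<(0 # cs) ! r}"
      then have "(2 * n + 1) * Suc m \<le> (2 * n + 1) * ((0 # cs) ! r)" by (intro mult_left_mono) auto
      then show "(2 * n + 1) * m + r \<le> (2 * n + 1) * ((0 # cs) ! r)" using r by simp
    qed
    then show "(\<Sum>m<(0 # cs) ! r. (2 * n + 1) * m + r) \<le> (2 * n + 1) * ((0 # cs) ! r)\<^sup>2"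
      by (simp add: power2_eq_square mult_ac)
  qed
  also have "\<dots> = (2 * n + 1) * (\<Sum>r<2 * n. (cs ! r)\<^sup>2)"
    by (simp add: sum.lessThan_Suc_shift sum_distrib_left del: sum.lessThan_Suc)
  finally have "real (\<Sum>r<2 * n + 1. \<Sum>m<(0 # cs) ! r. (2 * n + 1) * m + r)
      \<le> real ((2 * n + 1) * (\<Sum>r<2 * n. (cs ! r)\<^sup>2))" by (rule of_nat_mono)
  moreover have "real ((2 * n + 1) * (\<Sum>r<2 * n. (cs ! r)\<^sup>2))
      = real (2 * n + 1) * (\<Sum>r<2 * n. (real (cs ! r))\<^sup>2)"
    by (simp only: of_nat_mult of_nat_sum of_nat_power)
  moreover have "0 \<le> real N * (real N - 1) / 2" for N
    by (cases N) auto
  note this[of ?N]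
  ultimately show ?thesis unfolding psize_core_of[OF assms] by linarith
qed

lemma sum_lessThan_double: "(\<Sum>r<2 * n. f r) = (\<Sum>i<n. f (2 * i) + f (2 * i + 1))" for f :: "nat \<Rightarrow> real"
  by (induction n) (auto simp: algebra_simps)

text \<open>Only one letter of each pair of neighbours is nonzero, so the Cauchy-Schwarz inequality
  applies with \<open>n\<close> terms.  This gain over \<open>2 * n\<close> terms keeps the size comparable to the sum of squares.\<close>

lemma configs_sum_squared_le:
  assumes "n \<ge> 1" "cs \<in> configs n"
  shows "(\<Sum>r<2 * n. real (cs ! r))\<^sup>2 \<le> real n * (\<Sum>r<2 * n. (real (cs ! r))\<^sup>2)"
proof -
  have "(\<Sum>r<2 * n. real (cs ! r))\<^sup>2 = (\<Sum>i<n. real (cs ! (2 * i)) + real (cs ! (2 * i + 1)))\<^sup>2"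
    by (simp add: sum_lessThan_double)
  also have "\<dots> \<le> (\<Sum>i<n. (real (cs ! (2 * i)) + real (cs ! (2 * i + 1)))\<^sup>2) * real (card {..<n})"
    by (rule sum_squared_le_sum_of_squares)
  also have "(\<Sum>i<n. (real (cs ! (2 * i)) + real (cs ! (2 * i + 1)))\<^sup>2)
      = (\<Sum>i<n. (real (cs ! (2 * i)))\<^sup>2 + (real (cs ! (2 * i + 1)))\<^sup>2)"
  proof (intro sum.cong refl)
    fix i assume "i \<in> {..<n}"
    then have "2 * i < 2 * n - 1" by auto
    moreover have "step_conditions n (\<lambda>r. (0 # cs) ! r)"
      using assms by (simp add: configs_iff_step_conditions)
    ultimately have "(0 # cs) ! (2 * i + 1) = 0 \<or> (0 # cs) ! (2 * i + 2) = 0"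
      by (rule step_conditionsD(2)[rotated])
    then have "cs ! (2 * i) = 0 \<or> cs ! (2 * i + 1) = 0" by simp
    then show "(real (cs ! (2 * i)) + real (cs ! (2 * i + 1)))\<^sup>2
        = (real (cs ! (2 * i)))\<^sup>2 + (real (cs ! (2 * i + 1)))\<^sup>2" by auto
  qed
  also have "\<dots> = (\<Sum>r<2 * n. (real (cs ! r))\<^sup>2)" by (simp only: sum_lessThan_double)
  finally show ?thesis by (simp add: mult.commute)
qed

lemma sum_arith_progression_ge:
  "real s * (real c * (real c - 1) / 2) \<le> real (\<Sum>m<c. s * m + r)"
  by (induction c) (auto simp: algebra_simps)

text \<open>To leading order the size is half of \<open>s * Q - N\<^sup>2\<close>, where \<open>N\<close> is the sum of the letters.  As
  \<open>N\<^sup>2 \<le> n * Q\<close>, at most about half of \<open>s * Q\<close> cancels; \<open>Q \<ge> 16 * n\<close> makes the terms linear in \<open>N\<close>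
  negligible.\<close>

lemma psize_core_of_ge:
  assumes "n \<ge> 1" "cs \<in> configs n"
  defines "Q \<equiv> (\<Sum>r<2 * n. (real (cs ! r))\<^sup>2)"
  assumes Q: "16 * real n \<le> Q"
  shows "real n / 4 * Q \<le> psize (core_of n cs)"
proof -
  define N where "N = (\<Sum>r<2 * n. real (cs ! r))"
  have NQ: "N\<^sup>2 \<le> real n * Q" unfolding N_def Q_def by (rule configs_sum_squared_le[OF assms(1,2)])
  also have "\<dots> \<le> (Q / 4)\<^sup>2"
  proof -
    have "16 * real n * Q \<le> Q * Q" using Q by (intro mult_right_mono) (auto simp: Q_def sum_nonneg)
    then show ?thesis by (simp add: power2_eq_square)
  qed
  finally have N4: "N \<le> Q / 4"
    by (rule power2_le_imp_le) (simp add: Q_def sum_nonneg)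
  have N0: "0 \<le> N" by (simp add: N_def sum_nonneg)
  have "real (2 * n + 1) * ((Q - N) / 2)
      = (\<Sum>r<2 * n + 1. real (2 * n + 1) * (real ((0 # cs) ! r) * (real ((0 # cs) ! r) - 1) / 2))"
    unfolding Q_def N_def
    by (simp add: sum.lessThan_Suc_shift sum_distrib_left sum_subtractf[symmetric] sum_divide_distrib
        power2_eq_square right_diff_distrib del: sum.lessThan_Suc)
  also have "\<dots> \<le> (\<Sum>r<2 * n + 1. real (\<Sum>m<(0 # cs) ! r. (2 * n + 1) * m + r))"
    by (intro sum_mono sum_arith_progression_ge)
  also have "\<dots> = psize (core_of n cs) + N * (N - 1) / 2"
    unfolding psize_core_of[OF assms(1,2)] N_def by simp
  finally have "real (2 * n + 1) * ((Q - N) / 2) \<le> psize (core_of n cs) + N * (N - 1) / 2" .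
  moreover have "N * (N - 1) / 2 \<le> real n * Q / 2"
    using NQ N0 by (simp add: power2_eq_square algebra_simps)
  moreover have "real (2 * n + 1) * (3 / 8 * Q) \<le> real (2 * n + 1) * ((Q - N) / 2)"
    using N4 by (intro mult_left_mono) auto
  moreover have "0 \<le> Q" by (simp add: Q_def sum_nonneg)
  moreover have "real (2 * n + 1) * (3 / 8 * Q) = real n * Q / 2 + real n / 4 * Q + 3 / 8 * Q"
    by (simp add: field_simps)
  ultimately show ?thesis by linarith
qed

section \<open>Binomial estimates and the uniform distribution\<close>

lemma configs_subset:
  assumes "n \<ge> 1"
  shows "configs n \<subseteq> configs_at n 0 \<union> configs_at n 1 \<union> configs_at n 2 \<union> (\<Union>k\<in>{3..n + 1}. configs_at n k)"
proof
  fix cs assume cs: "cs \<in> configs n"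
  define k where "k = hd cs"
  have csk: "cs \<in> configs_at n k" using cs by (simp add: configs_at_def k_def)
  have "k \<le> n + 1" if "k \<ge> 3"
  proof (rule ccontr)
    assume "\<not> k \<le> n + 1"
    then have "card (configs_at n k) = 0" using card_configs_at[OF that assms] by simp
    then show False using csk finite_configs_at[of n k] by auto
  qed
  then consider "k = 0" | "k = 1" | "k = 2" | "k \<in> {3..n + 1}" by fastforce
  then show "cs \<in> configs_at n 0 \<union> configs_at n 1 \<union> configs_at n 2 \<union> (\<Union>k\<in>{3..n + 1}. configs_at n k)"
    using csk by cases auto
qed

lemma finite_configs: "n \<ge> 1 \<Longrightarrow> finite (configs n)"
  by (rule finite_subset[OF configs_subset]) (auto simp: finite_configs_at)

text \<open>First letters \<open>k \<ge> 3\<close> contribute distinct entries of one row of Pascal's triangle; the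
  three remaining first letters are covered by the growth rate of the path counts.\<close>

lemma card_configs_le:
  assumes "n \<ge> 1"
  shows "card (configs n) \<le> 4 * 4 ^ n"
proof -
  have small: "card (configs_at n k) \<le> card (paths_ge 0 (2 * n - 1) 0 k)" for k
    using card_mono[OF _ configs_at_subset[of n k]] by (simp add: finite_paths_ge card_image)
  have pow: "(2::nat) * 2 ^ (2 * n - 1) = 4 ^ n"
    using assms by (simp add: power_mult flip: power_Suc)
  have "(\<Sum>k\<in>{3..n + 1}. card (configs_at n k)) = (\<Sum>k\<in>{3..n + 1}. (2 * n + 1) choose (n + 1 - k))"
    using assms by (intro sum.cong refl) (simp add: card_configs_at)
  also have "\<dots> = (\<Sum>i\<in>(\<lambda>k. n + 1 - k) ` {3..n + 1}. (2 * n + 1) choose i)"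
    by (subst sum.reindex) (auto simp: inj_on_def)
  also have "\<dots> \<le> (\<Sum>i\<le>2 * n + 1. (2 * n + 1) choose i)"
    by (intro sum_mono2) auto
  also have "\<dots> = 2 * 4 ^ n" by (simp only: choose_row_sum) (simp add: power_mult)
  finally have large: "(\<Sum>k\<in>{3..n + 1}. card (configs_at n k)) \<le> 2 * 4 ^ n" .
  have "card (configs n) \<le> card (configs_at n 0 \<union> configs_at n 1 \<union> configs_at n 2 \<union> (\<Union>k\<in>{3..n + 1}. configs_at n k))"
    by (rule card_mono[OF _ configs_subset[OF assms]]) (auto simp: finite_configs_at)
  also have "\<dots> \<le> card (configs_at n 0) + card (configs_at n 1) + card (configs_at n 2)
      + (\<Sum>k\<in>{3..n + 1}. card (configs_at n k))"
    by (intro order.trans[OF card_Un_le] add_mono card_UN_le order.refl) auto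
  also have "\<dots> \<le> 2 ^ (2 * n - 1) + 2 ^ (2 * n - 1) + 2 * 2 ^ (2 * n - 1) + 2 * 4 ^ n"
  proof (intro add_mono large)
    show "card (configs_at n 0) \<le> 2 ^ (2 * n - 1)"
      using small[of 0] card_valid_paths_le[of "2 * n - 1" 0] by simp
    show "card (configs_at n 1) \<le> 2 ^ (2 * n - 1)"
      using small[of 1] card_valid_paths_le[of "2 * n - 1" 0] by simp
    show "card (configs_at n 2) \<le> 2 * 2 ^ (2 * n - 1)"
      using small[of 2] card_valid_paths_le[of "2 * n - 1" 1] by (simp add: numeral_2_eq_2)
  qed
  also have "\<dots> = 4 * 4 ^ n" using pow by simp
  finally show ?thesis .
qed

lemma central_binomial_squared_ge:
  assumes "n \<ge> 1"
  shows "(16::real) ^ n \<le> 4 * real n * (real ((2 * n) choose n))\<^sup>2"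
  using assms
proof (induction n rule: dec_induct)
  case base
  show ?case by (simp add: numeral_2_eq_2)
next
  case (step n)
  define B where "B = real ((2 * n) choose n)"
  have n: "real n \<ge> 1" using step by simp
  have "real (Suc n) * real ((2 * Suc n) choose Suc n) = 2 * (2 * real n + 1) * B"
  proof -
    have "Suc n * (Suc (Suc (2 * n)) choose Suc n) = Suc (Suc (2 * n)) * (Suc (2 * n) choose n)"
      by (metis Suc_times_binomial_eq mult.commute)
    moreover have "Suc n * (Suc (2 * n) choose n) = Suc (2 * n) * ((2 * n) choose n)"
    proof -
      have "Suc (2 * n) choose n = Suc (2 * n) choose Suc n"
        by (subst binomial_symmetric) (auto simp: Suc_diff_le)
      then show ?thesis by (metis Suc_times_binomial_eq mult.commute)
    qed
    ultimately have "Suc n * (Suc n * (Suc (Suc (2 * n)) choose Suc n)) = Suc n * (2 * (Suc (2 * n) * ((2 * n) choose n)))"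
      by (metis (no_types, lifting) mult.assoc mult.left_commute mult_2 add_Suc add_Suc_right)
    then have "Suc n * (Suc (Suc (2 * n)) choose Suc n) = 2 * (Suc (2 * n) * ((2 * n) choose n))"
      by (metis mult_cancel1 nat.distinct(1))
    from arg_cong[OF this, of real] show ?thesis
      unfolding B_def of_nat_mult by (simp del: binomial_Suc_Suc add: algebra_simps)
  qed
  then have C: "real ((2 * Suc n) choose Suc n) = 2 * (2 * real n + 1) * B / real (Suc n)"
    by (simp add: field_simps del: binomial_Suc_Suc)
  have "16 ^ Suc n \<le> 16 * (4 * real n * B\<^sup>2)" using step.IH by (simp add: B_def)
  also have "\<dots> \<le> 16 * ((2 * real n + 1)\<^sup>2 / (real n + 1) * B\<^sup>2)"
  proof (intro mult_left_mono mult_right_mono)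
    show "4 * real n \<le> (2 * real n + 1)\<^sup>2 / (real n + 1)"
      using n by (simp add: pos_le_divide_eq power2_eq_square algebra_simps)
  qed auto
  also have "\<dots> = 4 * real (Suc n) * (real ((2 * Suc n) choose Suc n))\<^sup>2"
  proof -
    have "4 * x * (a / x)\<^sup>2 = 4 * a\<^sup>2 / x" if "x > 0" for a x :: real
      using that by (simp add: power2_eq_square field_simps)
    then have "4 * real (Suc n) * (2 * (2 * real n + 1) * B / real (Suc n))\<^sup>2
        = 4 * (2 * (2 * real n + 1) * B)\<^sup>2 / real (Suc n)" by (simp del: of_nat_Suc)
    also have "(2 * (2 * real n + 1) * B)\<^sup>2 = 4 * ((2 * real n + 1)\<^sup>2 * B\<^sup>2)"
      by (simp only: power_mult_distrib) simp
    finally show ?thesis unfolding C by (simp add: add.commute)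
  qed
  finally show ?case .
qed

text \<open>Consecutive entries of the row have ratio \<open>(n + 1 - k) / (n + 1 + k)\<close>.\<close>

lemma choose_near_middle_ge:
  assumes "k \<ge> 1" "k \<le> J" "2 * J \<le> n"
  shows "real ((2 * n + 1) choose n) * (1 - 2 * real J / real n) ^ k
    \<le> real ((2 * n + 1) choose (n + 1 - k))"
  using assms
proof (induction k rule: dec_induct)
  case base
  have J: "0 \<le> 2 * real J / real n" "2 * real J / real n \<le> 1" using base by (auto simp: divide_le_eq_1)
  show ?case using mult_left_mono[of "1 - 2 * real J / real n" 1 "real ((2 * n + 1) choose n)"] J by simp
next
  case (step k)
  define m where "m = n - k"
  have m: "n + 1 - k = Suc m" "n + 1 - Suc k = m" "m + k = n" using step by (auto simp: m_def)
  have n: "n > 0" using step by simp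
  have q: "0 \<le> 1 - 2 * real J / real n" using step n by (simp add: divide_le_eq_1)
  have "Suc m * ((2 * n + 1) choose Suc m) = (2 * n + 1 - m) * ((2 * n + 1) choose m)"
    using binomial_absorb_comp[of "2 * n + 1" m] Suc_times_binomial[of m "2 * n"]
    by (simp del: binomial_Suc_Suc)
  then have eq: "real (Suc m) * real ((2 * n + 1) choose Suc m) = real (2 * n + 1 - m) * real ((2 * n + 1) choose m)"
    by (metis of_nat_mult)
  have d: "real (2 * n + 1 - m) = real n + 1 + real k" "real (Suc m) = real n + 1 - real k" using m by linarith+
  have le: "(1 - 2 * real J / real n) * (real n + 1 + real k) \<le> real n + 1 - real k"
  proof -
    have "2 * real k * real n \<le> 2 * real J * (real n + 1 + real k)"
      using step by (intro mult_mono) auto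
    then have "2 * real k \<le> 2 * real J / real n * (real n + 1 + real k)"
      using n by (simp add: field_simps)
    then show ?thesis by (simp add: algebra_simps)
  qed
  have "(real n + 1 + real k) * (real ((2 * n + 1) choose n) * (1 - 2 * real J / real n) ^ Suc k)
      = (1 - 2 * real J / real n) * (real n + 1 + real k) * (real ((2 * n + 1) choose n) * (1 - 2 * real J / real n) ^ k)"
    by simp
  also have "\<dots> \<le> (real n + 1 - real k) * real ((2 * n + 1) choose Suc m)"
    using step m q by (intro mult_mono le) auto
  also have "\<dots> = (real n + 1 + real k) * real ((2 * n + 1) choose m)"
    using eq unfolding d .
  finally show ?case unfolding m by (rule mult_left_le_imp_le) simp
qed

text \<open>For \<open>n = w\<^sup>2\<close> and \<open>k \<le> J * w\<close> the loss against the central coefficient is at most the factor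
  \<open>((1 - 2 * J / w)\<^sup>w)\<^sup>J\<close>, which converges to a positive limit.  Restricting to squares avoids square
  roots.\<close>

lemma card_configs_at_ge:
  fixes J :: nat
  obtains c where "c > 0" "eventually (\<lambda>w. \<forall>k. 3 \<le> k \<longrightarrow> k \<le> J * w \<longrightarrow>
      c * 4 ^ w\<^sup>2 / real w \<le> real (card (configs_at (w\<^sup>2) k))) sequentially"
proof -
  define e where "e = exp (- (2 * real J)) / 2"
  have e: "0 < e" by (simp add: e_def)
  have "(\<lambda>w. (1 + (- (2 * real J)) / real w) ^ w) \<longlonglongrightarrow> exp (- (2 * real J))"
    by (rule tendsto_exp_limit_sequentially)
  then have "eventually (\<lambda>w. e < (1 + (- (2 * real J)) / real w) ^ w) sequentially"
    by (rule order_tendstoD) (simp add: e_def)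
  then have "eventually (\<lambda>w. \<forall>k. 3 \<le> k \<longrightarrow> k \<le> J * w \<longrightarrow>
      (e ^ J / 2) * 4 ^ w\<^sup>2 / real w \<le> real (card (configs_at (w\<^sup>2) k))) sequentially"
    using eventually_ge_at_top[of "2 * J + 1"]
  proof eventually_elim
    case (elim w)
    show ?case
    proof (intro allI impI)
      fix k assume k: "3 \<le> k" "k \<le> J * w"
      define n where "n = w\<^sup>2"
      define q where "q = 1 - 2 * real J / real w"
      have w: "w \<ge> 1" using elim by simp
      have n: "n \<ge> 1" using w by (simp add: n_def)
      have q: "0 \<le> q" "q \<le> 1" using elim(2) by (auto simp: q_def divide_le_eq_1)
      have Jn: "2 * (J * w) \<le> n" using elim(2) by (simp add: n_def power2_eq_square)
      have "e ^ J \<le> (q ^ w) ^ J" using elim(1) e by (intro power_mono) (auto simp: q_def)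
      also have "\<dots> = q ^ (J * w)" by (simp only: power_mult[symmetric] mult.commute[of w J])
      also have "\<dots> \<le> q ^ k" using k q by (intro power_decreasing) auto
      finally have eq: "e ^ J \<le> q ^ k" .
      have "4 ^ n / (2 * real w) \<le> real ((2 * n) choose n)"
      proof (rule power2_le_imp_le)
        have "(4 ^ n)\<^sup>2 = (16::real) ^ n"
          by (simp add: power2_eq_square flip: power_mult_distrib)
        then show "(4 ^ n / (2 * real w))\<^sup>2 \<le> (real ((2 * n) choose n))\<^sup>2"
          using central_binomial_squared_ge[OF n] w
          by (simp add: power_divide power_mult_distrib n_def field_simps)
      qed simp
      also have "\<dots> \<le> real ((2 * n + 1) choose n)"
        using n by (cases n) auto
      finally have mid: "4 ^ n / (2 * real w) \<le> real ((2 * n + 1) choose n)" .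
      have "(e ^ J / 2) * 4 ^ n / real w = 4 ^ n / (2 * real w) * e ^ J" by simp
      also have "\<dots> \<le> real ((2 * n + 1) choose n) * q ^ k"
        using mid eq e by (intro mult_mono) auto
      also have "q = 1 - 2 * real (J * w) / real n"
        using w by (simp add: q_def n_def power2_eq_square)
      also have "real ((2 * n + 1) choose n) * (1 - 2 * real (J * w) / real n) ^ k
          \<le> real ((2 * n + 1) choose (n + 1 - k))"
        using k Jn by (intro choose_near_middle_ge) auto
      also have "\<dots> = real (card (configs_at n k))"
        using card_configs_at[OF k(1) n] k Jn by simp
      finally show "(e ^ J / 2) * 4 ^ w\<^sup>2 / real w \<le> real (card (configs_at (w\<^sup>2) k))"
        unfolding n_def .
    qed
  qed
  then show ?thesis using e by (intro that[of "e ^ J / 2"]) auto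
qed

lemma card_configs_filter_ge:
  assumes "n \<ge> 1" "b \<ge> 0"
    and "\<And>k. a < k \<Longrightarrow> k \<le> a + d \<Longrightarrow> b \<le> real (card {cs \<in> configs_at n k. P cs})"
  shows "real d * b \<le> real (card {cs \<in> configs n. P cs})"
proof -
  have "real d * b = (\<Sum>k\<in>{a<..a + d}. b)" by simp
  also have "\<dots> \<le> (\<Sum>k\<in>{a<..a + d}. real (card {cs \<in> configs_at n k. P cs}))"
    by (intro sum_mono assms) auto
  also have "\<dots> = real (card (\<Union>k\<in>{a<..a + d}. {cs \<in> configs_at n k. P cs}))"
  proof (subst card_UN_disjoint)
    show "\<forall>k\<in>{a<..a + d}. finite {cs \<in> configs_at n k. P cs}" by (simp add: finite_configs_at)
  qed (auto simp: configs_at_def)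
  also have "\<dots> \<le> real (card {cs \<in> configs n. P cs})"
    unfolding of_nat_le_iff
    by (rule card_mono) (use finite_configs[OF assms(1)] in \<open>auto simp: configs_at_def\<close>)
  finally show ?thesis .
qed

lemma measure_core_pmf:
  assumes "n \<ge> 1"
  shows "measure (measure_pmf (core_pmf n)) {xs. P xs}
    = real (card {cs \<in> configs n. P (core_of n cs)}) / real (card (configs n))"
proof -
  let ?S = "distinct_cores (2 * n + 1) (2 * n + 3)"
  note bij = bij_betw_core_of[OF assms]
  have S: "?S = core_of n ` configs n" using bij by (simp add: bij_betw_def)
  have fin: "finite ?S" unfolding S using finite_configs[OF assms] by simp
  have "replicate (2 * n) 0 \<in> configs n"
    using assms by (subst configs_iff_step_conditions) (auto simp: step_conditions_def nth_Cons')
  then have ne: "?S \<noteq> {}" unfolding S by blast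
  have "card (?S \<inter> {xs. P xs}) = card (core_of n ` {cs \<in> configs n. P (core_of n cs)})"
    unfolding S by (intro arg_cong[where f=card]) auto
  also have "\<dots> = card {cs \<in> configs n. P (core_of n cs)}"
    using bij by (intro card_image) (auto simp: bij_betw_def intro: inj_on_subset)
  finally show ?thesis
    unfolding core_pmf_def using fin ne bij_betw_same_card[OF bij]
    by (simp add: measure_pmf_of_set)
qed

section \<open>Asymptotic normality of nonnegative variables\<close>

lemma isCont_cdf_std_normal: "isCont (cdf std_normal_distribution) x"
proof -
  interpret real_distribution std_normal_distribution by (rule real_dist_normal_dist)
  have "emeasure std_normal_distribution {x} = 0"
    by (subst emeasure_density) (auto intro!: nn_integral_null_set)
  then have "measure std_normal_distribution {x} = 0" by (simp add: measure_def)
  then show ?thesis by (simp add: isCont_cdf)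
qed

lemma cdf_std_normal_pos: "cdf std_normal_distribution x > 0"
proof -
  interpret real_distribution std_normal_distribution by (rule real_dist_normal_dist)
  have "emeasure std_normal_distribution {..x} \<noteq> 0"
  proof
    assume "emeasure std_normal_distribution {..x} = 0"
    then have "(\<integral>\<^sup>+ y. ennreal (std_normal_density y) * indicator {..x} y \<partial>lborel) = 0"
      by (subst (asm) emeasure_density) auto
    then have "AE y in lborel. ennreal (std_normal_density y) * indicator {..x} y = 0"
      by (subst (asm) nn_integral_0_iff_AE) auto
    then have "AE y in lborel. y \<notin> {..x}"
    proof eventually_elim
      case (elim y)
      then show ?case using normal_density_pos[of 1 0 y] by (auto simp: indicator_def split: if_splits)
    qed
    then have "emeasure lborel {..x} = 0"
      by (subst (asm) AE_iff_measurable[of "{..x}"]) auto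
    moreover have "emeasure lborel {x - 1..x} \<le> emeasure lborel {..x}"
      by (rule emeasure_mono) auto
    ultimately show False by simp
  qed
  then have "measure std_normal_distribution {..x} \<noteq> 0" by (simp add: emeasure_eq_measure)
  then show ?thesis unfolding cdf_def by (metis measure_nonneg less_eq_real_def)
qed

lemma cdf_distr_pmf: "cdf (distr (measure_pmf p) borel f) x = measure (measure_pmf p) {\<omega>. f \<omega> \<le> x}"
  by (simp add: cdf_def measure_distr vimage_def)

text \<open>The left tail of the normal law forces \<open>\<mu> \<ge> 3 * L * \<sigma>\<close> for any given \<open>L\<close>.  If each of the
  tails beyond \<open>L\<close> has mass less than \<open>c\<close>, an event \<open>X \<le> a\<close> of probability at least \<open>c\<close> requires
  \<open>a > \<mu> - L * \<sigma>\<close>, and an event \<open>X \<ge> 2 * a\<close> of that probability requires \<open>2 * a \<le> \<mu> + L * \<sigma>\<close>;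
  together they contradict \<open>\<mu> \<ge> 3 * L * \<sigma>\<close>.\<close>

lemma nonneg_asymp_normal_concentrates:
  fixes p :: "nat \<Rightarrow> 'a pmf" and X :: "'a \<Rightarrow> real" and c :: real
  assumes conv: "weak_conv_m (\<lambda>k. distr (measure_pmf (p k)) borel (standardized (p k) X))
      std_normal_distribution"
    and nonneg: "\<And>x. X x \<ge> 0" and c: "c > 0"
  shows "eventually (\<lambda>k. \<forall>a. \<not> (c \<le> measure (measure_pmf (p k)) {x. X x \<le> a} \<and>
      c \<le> measure (measure_pmf (p k)) {x. 2 * a \<le> X x})) sequentially"
proof -
  interpret real_distribution std_normal_distribution by (rule real_dist_normal_dist)
  define F where "F = cdf std_normal_distribution"
  define G where "G k = cdf (distr (measure_pmf (p k)) borel (standardized (p k) X))" for k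
  have G: "G k x = measure (measure_pmf (p k)) {\<omega>. standardized (p k) X \<omega> \<le> x}" for k x
    by (simp add: G_def cdf_distr_pmf)
  have lim: "(\<lambda>k. G k x) \<longlonglongrightarrow> F x" for x
    using conv isCont_cdf_std_normal unfolding weak_conv_m_def weak_conv_def F_def G_def by blast
  have "eventually (\<lambda>x. F x > 1 - c) at_top"
    unfolding F_def using order_tendstoD(1)[OF cdf_lim_at_top_prob, of "1 - c"] c by simp
  moreover have "eventually (\<lambda>x. F (- x) < c) at_top"
  proof -
    have "eventually (\<lambda>x. F x < c) at_bot"
      unfolding F_def using order_tendstoD(2)[OF cdf_lim_at_bot c] .
    then show ?thesis by (simp add: at_bot_mirror eventually_filtermap)
  qed
  moreover have "eventually (\<lambda>x. x > (0::real)) at_top" by (rule eventually_gt_at_top)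
  ultimately have "eventually (\<lambda>x. F x > 1 - c \<and> F (- x) < c \<and> x > 0) at_top"
    by eventually_elim auto
  then obtain L where L: "F L > 1 - c" "F (- L) < c" "L > 0"
    using eventually_happens' trivial_limit_at_top_linorder by blast
  have "eventually (\<lambda>k. G k (- (3 * L)) > 0) sequentially"
    using order_tendstoD(1)[OF lim] cdf_std_normal_pos unfolding F_def by blast
  moreover have "eventually (\<lambda>k. G k L > 1 - c) sequentially" using order_tendstoD(1)[OF lim L(1)] .
  moreover have "eventually (\<lambda>k. G k (- L) < c) sequentially" using order_tendstoD(2)[OF lim L(2)] .
  ultimately show ?thesis
  proof eventually_elim
    case (elim k)
    \<comment> \<open>A point far out in the left tail exists; it also rules out \<open>\<sigma> = 0\<close>, where \<open>Z\<close> would vanish.\<close>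
    define \<mu> where "\<mu> = measure_pmf.expectation (p k) X"
    define \<sigma> where "\<sigma> = sqrt (measure_pmf.variance (p k) X)"
    define Z where "Z = standardized (p k) X"
    have Z: "Z x = (X x - \<mu>) / \<sigma>" for x by (simp add: Z_def standardized_def \<mu>_def \<sigma>_def)
    have \<sigma>0: "\<sigma> \<ge> 0" by (simp add: \<sigma>_def)
    have "{\<omega>. Z \<omega> \<le> - (3 * L)} \<noteq> {}"
      using elim(1) unfolding G Z_def[symmetric] by (metis less_irrefl measure_empty)
    then obtain x0 where x0: "Z x0 \<le> - (3 * L)" by blast
    have \<sigma>: "\<sigma> > 0" using x0 L(3) \<sigma>0 by (cases "\<sigma> = 0") (auto simp: Z)
    have "X x0 - \<mu> \<le> - (3 * L) * \<sigma>" using x0 \<sigma> by (simp add: Z pos_divide_le_eq)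
    then have \<mu>: "3 * L * \<sigma> \<le> \<mu>" using nonneg[of x0] by simp
    show ?case
    proof (intro allI notI, elim conjE)
      fix a
      assume a: "c \<le> measure (measure_pmf (p k)) {x. X x \<le> a}"
        and a2: "c \<le> measure (measure_pmf (p k)) {x. 2 * a \<le> X x}"
      have "\<not> {x. X x \<le> a} \<subseteq> {x. Z x \<le> - L}"
      proof
        assume "{x. X x \<le> a} \<subseteq> {x. Z x \<le> - L}"
        then have "measure (measure_pmf (p k)) {x. X x \<le> a} \<le> measure (measure_pmf (p k)) {x. Z x \<le> - L}"
          by (intro measure_pmf.finite_measure_mono) auto
        then show False using a elim(3) unfolding G Z_def by simp
      qed
      then obtain x where x: "X x \<le> a" "Z x > - L" by force
      have "\<not> {x. 2 * a \<le> X x} \<subseteq> - {x. Z x \<le> L}"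
      proof
        assume "{x. 2 * a \<le> X x} \<subseteq> - {x. Z x \<le> L}"
        then have "measure (measure_pmf (p k)) {x. 2 * a \<le> X x} \<le> measure (measure_pmf (p k)) (- {x. Z x \<le> L})"
          by (intro measure_pmf.finite_measure_mono) auto
        also have "\<dots> = 1 - measure (measure_pmf (p k)) {x. Z x \<le> L}"
          using measure_pmf.prob_compl[of "{x. Z x \<le> L}" "p k"] by (simp add: Compl_eq_Diff_UNIV)
        finally show False using a2 elim(2) unfolding G Z_def by simp
      qed
      then obtain y where y: "2 * a \<le> X y" "Z y \<le> L" by blast
      have "X x - \<mu> > - L * \<sigma>" using x(2) \<sigma> by (simp add: Z pos_less_divide_eq)
      moreover have "X y - \<mu> \<le> L * \<sigma>" using y(2) \<sigma> by (simp add: Z pos_divide_le_eq)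
      ultimately show False using \<mu> x(1) y(1) by simp
    qed
  qed
qed

section \<open>The size at two different scales\<close>

lemma measure_core_pmf_ge:
  assumes "n \<ge> 1" "c > 0" "c / 2 * 4 ^ n \<le> real (card {cs \<in> configs n. P (core_of n cs)})"
  shows "c / 8 \<le> measure (measure_pmf (core_pmf n)) {xs. P xs}"
proof -
  let ?S = "{cs \<in> configs n. P (core_of n cs)}"
  have "0 < c / 2 * 4 ^ n" using assms by simp
  then have "0 < card ?S" using assms(3) by linarith
  moreover have "card ?S \<le> card (configs n)"
    by (rule card_mono[OF finite_configs[OF assms(1)]]) auto
  ultimately have pos: "0 < card (configs n)" by simp
  have "real (card (configs n)) \<le> real (4 * 4 ^ n)"
    using card_configs_le[OF assms(1)] by (intro of_nat_mono)
  then have le: "real (card (configs n)) \<le> 4 * 4 ^ n" by simp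
  have "c / 8 = (c / 2 * 4 ^ n) / (4 * 4 ^ n)" by simp
  also have "\<dots> \<le> real (card ?S) / real (card (configs n))"
    using assms le pos by (intro frac_le) auto
  finally show ?thesis unfolding measure_core_pmf[OF assms(1)] .
qed

text \<open>A first letter between \<open>w\<close> and \<open>2 * w\<close> often leads to a small size, a first letter between
  \<open>1200 * w\<close> and \<open>2400 * w\<close> to a large one; the factor 1200 compensates for all constants lost in the comparison of the size with
  the sum of squares and in the moment estimates.\<close>

lemma core_size_not_concentrated:
  obtains c :: real where "c > 0" "eventually (\<lambda>w.
      c \<le> measure (measure_pmf (core_pmf (w\<^sup>2))) {xs. psize xs \<le> 480 * real (w\<^sup>2) ^ 3} \<and>
      c \<le> measure (measure_pmf (core_pmf (w\<^sup>2))) {xs. 2 * (480 * real (w\<^sup>2) ^ 3) \<le> psize xs})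
    sequentially"
proof -
  obtain c where c: "c > 0" and ev: "eventually (\<lambda>w. \<forall>k. 3 \<le> k \<longrightarrow> k \<le> 2400 * w \<longrightarrow>
      c * 4 ^ w\<^sup>2 / real w \<le> real (card (configs_at (w\<^sup>2) k))) sequentially"
    using card_configs_at_ge[of 2400] by blast
  \<comment> \<open>As \<open>19200 = 8 * 2400\<close>, every \<open>k \<le> 2400 * w\<close> satisfies \<open>8 * k \<le> w\<^sup>2\<close>.\<close>
  from ev eventually_ge_at_top[of 19200]
  have "eventually (\<lambda>w.
      c / 8 \<le> measure (measure_pmf (core_pmf (w\<^sup>2))) {xs. psize xs \<le> 480 * real (w\<^sup>2) ^ 3} \<and>
      c / 8 \<le> measure (measure_pmf (core_pmf (w\<^sup>2))) {xs. 2 * (480 * real (w\<^sup>2) ^ 3) \<le> psize xs})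
    sequentially"
  proof eventually_elim
    case (elim w)
    define n where "n = w\<^sup>2"
    have n: "n \<ge> 1" and w: "w \<ge> 3" using elim(2) by (auto simp: n_def)
    define Q where "Q cs = (\<Sum>r<2 * n. (real (cs ! r))\<^sup>2)" for cs
    have many: "c * 4 ^ n / real w \<le> real (card (configs_at n k))" if "3 \<le> k" "k \<le> 2400 * w" for k
      using elim(1) that unfolding n_def by blast
    have k8: "8 * k \<le> n" if "k \<le> 2400 * w" for k
    proof -
      have "8 * k \<le> 19200 * w" using that by simp
      also have "\<dots> \<le> w * w" using elim(2) by (rule mult_le_mono1)
      finally show ?thesis by (simp add: n_def power2_eq_square)
    qed
    \<comment> \<open>Small sizes: half of the words with first letter in \<open>{w<..2 * w}\<close>.\<close>
    have "real w * (c * 4 ^ n / (2 * real w)) \<le> real (card {cs \<in> configs n. psize (core_of n cs) \<le> 480 * real n ^ 3})"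
    proof (rule card_configs_filter_ge[OF n, where a=w])
      fix k assume k: "w < k" "k \<le> w + w"
      have "k\<^sup>2 \<le> (2 * w)\<^sup>2" using k by (intro power_mono) auto
      then have "k\<^sup>2 \<le> 4 * n" by (simp add: n_def power_mult_distrib)
      then have "real (card (configs_at n k)) \<le> 2 * real (card {cs \<in> configs_at n k. Q cs \<le> 160 * (real n)\<^sup>2})"
        unfolding Q_def using k w k8 by (intro many_configs_with_small_squares) auto
      also have "card {cs \<in> configs_at n k. Q cs \<le> 160 * (real n)\<^sup>2}
          \<le> card {cs \<in> configs_at n k. psize (core_of n cs) \<le> 480 * real n ^ 3}"
      proof (rule card_mono)
        show "{cs \<in> configs_at n k. Q cs \<le> 160 * (real n)\<^sup>2}
            \<subseteq> {cs \<in> configs_at n k. psize (core_of n cs) \<le> 480 * real n ^ 3}"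
        proof clarify
          fix cs assume cs: "cs \<in> configs_at n k" "Q cs \<le> 160 * (real n)\<^sup>2"
          have "psize (core_of n cs) \<le> real (2 * n + 1) * Q cs"
            unfolding Q_def using cs n by (intro psize_core_of_le) (auto simp: configs_at_def)
          also have "\<dots> \<le> (3 * real n) * (160 * (real n)\<^sup>2)"
            using cs n by (intro mult_mono) (auto simp: Q_def sum_nonneg)
          finally show "psize (core_of n cs) \<le> 480 * real n ^ 3"
            by (simp add: power2_eq_square power3_eq_cube)
        qed
      qed (simp add: finite_configs_at)
      finally have "real (card (configs_at n k)) / 2 \<le> real (card {cs \<in> configs_at n k. psize (core_of n cs) \<le> 480 * real n ^ 3})"
        by simp
      moreover have "c * 4 ^ n / (2 * real w) = c * 4 ^ n / real w / 2" by simp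
      moreover have "c * 4 ^ n / real w \<le> real (card (configs_at n k))"
        using k w by (intro many) auto
      ultimately show "c * 4 ^ n / (2 * real w) \<le> real (card {cs \<in> configs_at n k. psize (core_of n cs) \<le> 480 * real n ^ 3})"
        by linarith
    qed (use c in simp)
    then have small: "c / 8 \<le> measure (measure_pmf (core_pmf n)) {xs. psize xs \<le> 480 * real n ^ 3}"
      using w by (intro measure_core_pmf_ge n c) simp
    \<comment> \<open>Large sizes: a quarter of the words with first letter in \<open>{1200 * w<..2400 * w}\<close>.\<close>
    have "real (1200 * w) * (c * 4 ^ n / (4 * real w))
        \<le> real (card {cs \<in> configs n. 2 * (480 * real n ^ 3) \<le> psize (core_of n cs)})"
    proof (rule card_configs_filter_ge[OF n, where a="1200 * w"])
      fix k assume k: "1200 * w < k" "k \<le> 1200 * w + 1200 * w"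
      have kw: "(1200 * w)\<^sup>2 \<le> k\<^sup>2" using k by (intro power_mono) auto
      then have "64 * n \<le> k\<^sup>2" by (simp add: n_def power_mult_distrib)
      then have "real (card (configs_at n k)) \<le> 4 * real (card {cs \<in> configs_at n k. real n * (real k)\<^sup>2 / 320 \<le> Q cs})"
        unfolding Q_def using k w k8 by (intro many_configs_with_large_squares) auto
      also have "card {cs \<in> configs_at n k. real n * (real k)\<^sup>2 / 320 \<le> Q cs}
          \<le> card {cs \<in> configs_at n k. 2 * (480 * real n ^ 3) \<le> psize (core_of n cs)}"
      proof (rule card_mono)
        show "{cs \<in> configs_at n k. real n * (real k)\<^sup>2 / 320 \<le> Q cs}
            \<subseteq> {cs \<in> configs_at n k. 2 * (480 * real n ^ 3) \<le> psize (core_of n cs)}"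
        proof clarify
          fix cs assume cs: "cs \<in> configs_at n k" "real n * (real k)\<^sup>2 / 320 \<le> Q cs"
          have "real ((1200 * w)\<^sup>2) \<le> real (k\<^sup>2)" using kw by (rule of_nat_mono)
          then have "1440000 * real n \<le> (real k)\<^sup>2" by (simp add: n_def power_mult_distrib)
          then have "real n * (1440000 * real n) / 320 \<le> real n * (real k)\<^sup>2 / 320"
            by (intro divide_right_mono mult_left_mono) auto
          then have Q: "4500 * (real n)\<^sup>2 \<le> Q cs" using cs(2) by (simp add: power2_eq_square)
          have "real n \<le> (real n)\<^sup>2" using n by (simp add: power2_eq_square)
          then have "16 * real n \<le> Q cs" using Q zero_le_power2[of "real n"] by linarith
          then have "real n / 4 * Q cs \<le> psize (core_of n cs)"
            unfolding Q_def using cs n by (intro psize_core_of_ge) (auto simp: configs_at_def)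
          moreover have "real n / 4 * (4500 * (real n)\<^sup>2) \<le> real n / 4 * Q cs"
            using Q by (intro mult_left_mono) auto
          moreover have "real n / 4 * (4500 * (real n)\<^sup>2) = 1125 * real n ^ 3"
            by (simp add: power2_eq_square power3_eq_cube)
          moreover have "0 \<le> real n ^ 3" by simp
          ultimately show "2 * (480 * real n ^ 3) \<le> psize (core_of n cs)" by linarith
        qed
      qed (simp add: finite_configs_at)
      finally have "real (card (configs_at n k)) / 4 \<le> real (card {cs \<in> configs_at n k. 2 * (480 * real n ^ 3) \<le> psize (core_of n cs)})"
        by simp
      moreover have "c * 4 ^ n / (4 * real w) = c * 4 ^ n / real w / 4" by simp
      moreover have "c * 4 ^ n / real w \<le> real (card (configs_at n k))"
        using k w by (intro many) auto
      ultimately show "c * 4 ^ n / (4 * real w) \<le> real (card {cs \<in> configs_at n k. 2 * (480 * real n ^ 3) \<le> psize (core_of n cs)})"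
        by linarith
    qed (use c in simp)
    moreover have "c / 2 * 4 ^ n \<le> real (1200 * w) * (c * 4 ^ n / (4 * real w))"
      using w c by simp
    ultimately have "c / 8 \<le> measure (measure_pmf (core_pmf n)) {xs. 2 * (480 * real n ^ 3) \<le> psize xs}"
      by (intro measure_core_pmf_ge n c) linarith
    with small show ?case unfolding n_def by blast
  qed
  then show ?thesis using c by (intro that[of "c / 8"]) auto
qed

theorem mainTheorem8:
  shows "\<not> weak_conv_m
      (\<lambda>k. distr (measure_pmf (core_pmf (Suc k))) borel
             (standardized (core_pmf (Suc k)) psize))
      std_normal_distribution"
proof
  assume conv: "weak_conv_m
      (\<lambda>k. distr (measure_pmf (core_pmf (Suc k))) borel
             (standardized (core_pmf (Suc k)) psize))
      std_normal_distribution"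
  obtain c where c: "c > 0" and spread: "eventually (\<lambda>w.
      c \<le> measure (measure_pmf (core_pmf (w\<^sup>2))) {xs. psize xs \<le> 480 * real (w\<^sup>2) ^ 3} \<and>
      c \<le> measure (measure_pmf (core_pmf (w\<^sup>2))) {xs. 2 * (480 * real (w\<^sup>2) ^ 3) \<le> psize xs})
    sequentially" by (rule core_size_not_concentrated)
  have "psize xs \<ge> 0" for xs by (simp add: psize_def)
  from nonneg_asymp_normal_concentrates[OF conv this c]
  have conc: "eventually (\<lambda>k. \<forall>a. \<not> (c \<le> measure (measure_pmf (core_pmf (Suc k))) {xs. psize xs \<le> a} \<and>
      c \<le> measure (measure_pmf (core_pmf (Suc k))) {xs. 2 * a \<le> psize xs})) sequentially" .
  \<comment> \<open>The random variable with index \<open>k\<close> belongs to \<open>n = k + 1\<close>, hence the shift by one.\<close>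
  have "filterlim (\<lambda>w::nat. w\<^sup>2 - 1) sequentially sequentially"
    unfolding filterlim_at_top
  proof
    fix N :: nat
    show "eventually (\<lambda>w. N \<le> w\<^sup>2 - 1) sequentially"
      using eventually_ge_at_top[of "Suc N"]
    proof eventually_elim
      case (elim w)
      then have "Suc N * 1 \<le> w * w" by (intro mult_le_mono) auto
      then show ?case by (simp add: power2_eq_square)
    qed
  qed
  from eventually_compose_filterlim[OF conc this] spread eventually_ge_at_top[of 1]
  have "eventually (\<lambda>w::nat. False) sequentially"
  proof eventually_elim
    case (elim w)
    then have "Suc (w\<^sup>2 - 1) = w\<^sup>2" by (simp add: Suc_diff_le)
    then show ?case using elim(1,2) by metis
  qed
  then show False by simp
qed

end
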